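(* Let $\theta$ be a Salem number of degree $4$, let $m$ be a positive integer, and let $P_m(x)=\sum_{j=0}^m a_jx^j$ be a polynomial of degree $m$ with integer coefficients. Put $u(n)=P_m(\theta^n)$ for $n\in\mathbb{N}$. Let $Q_m(x)=-2\sum_{j=0}^m a_jT_j(x)$, where $T_j$ is the Chebyshev polynomial of the first kind of degree $j$ (so $T_j(\cos t)=\cos(jt)$), and let $Q^{-1}_1,Q^{-1}_2,\ldots,Q^{-1}_K$ be all branches of the inverse function of $Q_m$ restricted to the domain $[-1,1]$. If the domain of $Q_k^{-1}$ is $[\alpha_k,\beta_k]$ with $\alpha_k<\beta_k$ ($k=1,\ldots,K$), define its extension $S_k:\mathbb{R}\to\mathbb{R}$ by $$S_k(x)=\begin{cases}Q_k^{-1}(x), & x\in[\alpha_k,\beta_k],\\ Q_k^{-1}(\alpha_k), & x<\alpha_k,\\ Q_k^{-1}(\beta_k), & x>\beta_k,\end{cases}$$ in the case $Q_k^{-1}$ is decreasing on $[\alpha_k,\beta_k]$, and $$S_k(x)=\begin{cases}-Q_k^{-1}(x), & x\in[\alpha_k,\beta_k],\\ -Q_k^{-1}(\alpha_k), & x<\alpha_k,\\ -Q_k^{-1}(\beta_k), & x>\beta_k,\end{cases}$$ in the case $Q_k^{-1}$ is increasing on $[\alpha_k,\beta_k]$. Let $g(x)=\pi^{-1}\sum_{k=1}^K\arccos(S_k(x))$ and let $M$ be a natural number with $M\ge \max\{|\alpha_1|,\ldots,|\alpha_K|,|\beta_1|,\ldots,|\beta_K|\}$. Then the repartition function of the sequence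 $(u(n))$ is $$f(x)=\sum_{i=-M}^{M}\bigl(g(x+i)-g(i)\bigr),\qquad 0\le x\le 1,$$ and its first derivative is $$f'(x)=\pi^{-1}\sum_{i=-M}^{M}\sum_{k=1}^K\Bigl|\bigl(\arccos(Q^{-1}_k(x+i))\bigr)'\Bigr|,$$ where a summand is taken to be $0$ when $x+i\notin[\alpha_k,\beta_k]$.
   Context: A Salem number is a real algebraic integer $\theta>1$ whose conjugates other than itself all have modulus at most $1$, with at least one of modulus exactly $1$; for degree $4$ the conjugates are $\theta^{-1},e^{2\pi i\omega},e^{-2\pi i\omega}$. For a real sequence $(u(n))$, its repartition function is $f(x)=\lim_{N\to\infty}\frac1N\,\mathrm{card}\{n<N:\{u(n)\}<x\}$ for $0\le x\le 1$, where $\{y\}=y-\lfloor y\rfloor$ is the fractional part. Branches of the inverse: take the partition $-1=x_0<x_1<\cdots<x_K=1$ of $[-1,1]$ such that $x_1,\dots,x_{K-1}$ are the zeros of $Q_m'$ in $(-1,1)$ and $Q_m'$ has constant sign on each $(x_{k-1},x_k)$; $Q_k^{-1}$ is the inverse of $Q_m$ restricted to $[x_{k-1},x_k]$, whose domain is the image $[\alpha_k,\beta_k]=Q_m([x_{k-1},x_k])$.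
   Formalization: The formula for f'(x) is stated for x in [0,1] (one-sided at 0 and 1) except the finitely many x for which some x+i with |i| at most M equals an α_k or β_k; there the derivative of arccos(Q_k^{-1}) is infinite, so the summand is undefined. *)

theory Defs
  imports "HOL-Analysis.Analysis" "HOL-Computational_Algebra.Computational_Algebra"
begin

section \<open>Salem numbers\<close>

text \<open>The minimal polynomial over the rationals; meaningful only for algebraic \<open>z\<close>, where the
  description is uniquely satisfied.\<close>

definition min_poly :: "complex \<Rightarrow> rat poly" where
  "min_poly z = (THE p. irreducible p \<and> lead_coeff p = 1 \<and> poly (map_poly of_rat p) z = 0)"

definition conjugates :: "complex \<Rightarrow> complex set" where
  "conjugates z = {w. poly (map_poly of_rat (min_poly z)) w = 0}"

definition salem_number :: "real \<Rightarrow> bool" where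
  "salem_number \<theta> \<longleftrightarrow> algebraic_int \<theta> \<and> \<theta> > 1 \<and>
     (\<forall>w \<in> conjugates (complex_of_real \<theta>) - {complex_of_real \<theta>}. norm w \<le> 1) \<and>
     (\<exists>w \<in> conjugates (complex_of_real \<theta>) - {complex_of_real \<theta>}. norm w = 1)"

definition algebraic_degree :: "complex \<Rightarrow> nat" where
  "algebraic_degree z = degree (min_poly z)"


section \<open>Repartition functions\<close>

definition has_repartition_function :: "(nat \<Rightarrow> real) \<Rightarrow> (real \<Rightarrow> real) \<Rightarrow> bool" where
  "has_repartition_function u f \<longleftrightarrow>
     (\<forall>x\<in>{0..1}. (\<lambda>N. real (card {n. n < N \<and> frac (u n) < x}) / real N) \<longlonglongrightarrow> f x)"


section \<open>The polynomial \<open>Q\<close> and the branches of its inverse\<close>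

fun Cheb_T :: "nat \<Rightarrow> real poly" where
  "Cheb_T 0 = 1"
| "Cheb_T (Suc 0) = [:0, 1:]"
| "Cheb_T (Suc (Suc n)) = [:0, 2:] * Cheb_T (Suc n) - Cheb_T n"

lemma poly_Cheb_T_cos: "poly (Cheb_T n) (cos t) = cos (real n * t)"
proof (induction n rule: Cheb_T.induct)
  case (3 n)
  have "cos (real (Suc (Suc n)) * t) + cos (real n * t) = 2 * cos t * cos (real (Suc n) * t)"
    using cos_add[of "real (Suc n) * t" t] cos_diff[of "real (Suc n) * t" t]
    by (simp add: algebra_simps)
  with 3 show ?case by simp
qed auto

definition Q_poly :: "int poly \<Rightarrow> real poly" where
  "Q_poly P = smult (-2) (\<Sum>j\<le>degree P. smult (of_int (coeff P j)) (Cheb_T j))"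

text \<open>\<open>c 0 < \<dots> < c K\<close> is the partition of \<open>[-1, 1]\<close> at the zeros of \<open>Q'\<close> (including those where
  \<open>Q'\<close> does not change sign).\<close>

definition critical_partition :: "real poly \<Rightarrow> nat \<Rightarrow> (nat \<Rightarrow> real) \<Rightarrow> bool" where
  "critical_partition Q K c \<longleftrightarrow>
     c 0 = -1 \<and> c K = 1 \<and> strict_mono_on {0..K} c \<and>
     c ` {1..<K} = {x. -1 < x \<and> x < 1 \<and> poly (pderiv Q) x = 0} \<and>
     (\<forall>k\<in>{1..K}. (\<forall>x\<in>{c (k-1)<..<c k}. poly (pderiv Q) x > 0) \<or>
                 (\<forall>x\<in>{c (k-1)<..<c k}. poly (pderiv Q) x < 0))"

definition inverse_branch :: "real poly \<Rightarrow> (nat \<Rightarrow> real) \<Rightarrow> nat \<Rightarrow> real \<Rightarrow> real" where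
  "inverse_branch Q c k = inv_into {c (k-1)..c k} (poly Q)"

text \<open>The extension \<open>S\<close> of a branch \<open>r\<close> with domain \<open>[a, b]\<close>; branches are strictly monotone, so the
  last case is that of an increasing \<open>r\<close>.\<close>

definition extend_branch :: "(real \<Rightarrow> real) \<Rightarrow> real \<Rightarrow> real \<Rightarrow> real \<Rightarrow> real" where
  "extend_branch r a b x =
     (let y = (if x < a then r a else if x > b then r b else r x)
      in if strict_antimono_on {a..b} r then y else - y)"

definition g_fun ::
  "real poly \<Rightarrow> nat \<Rightarrow> (nat \<Rightarrow> real) \<Rightarrow> (nat \<Rightarrow> real) \<Rightarrow> (nat \<Rightarrow> real) \<Rightarrow> real \<Rightarrow> real" where
  "g_fun Q K c \<alpha> \<beta> x =
     (1 / pi) * (\<Sum>k=1..K. arccos (extend_branch (inverse_branch Q c k) (\<alpha> k) (\<beta> k) x))"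

definition f_fun ::
  "real poly \<Rightarrow> nat \<Rightarrow> (nat \<Rightarrow> real) \<Rightarrow> (nat \<Rightarrow> real) \<Rightarrow> (nat \<Rightarrow> real) \<Rightarrow> nat \<Rightarrow> real \<Rightarrow> real" where
  "f_fun Q K c \<alpha> \<beta> M x =
     (\<Sum>i=-int M..int M. g_fun Q K c \<alpha> \<beta> (x + of_int i) - g_fun Q K c \<alpha> \<beta> (of_int i))"

text \<open>The formula for \<open>f'\<close>. At \<open>x + i \<in> {\<alpha> k, \<beta> k}\<close> the map \<open>t \<mapsto> Q (cos t)\<close> has a critical point, so
  the derivative of its inverse \<open>arccos \<circ> Q\<^sub>k\<^sup>-\<^sup>1\<close> is infinite there and the formula has no
  real value; \<^const>\<open>deriv\<close> is meaningful only away from these points.\<close>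

definition f_deriv ::
  "real poly \<Rightarrow> nat \<Rightarrow> (nat \<Rightarrow> real) \<Rightarrow> (nat \<Rightarrow> real) \<Rightarrow> (nat \<Rightarrow> real) \<Rightarrow> nat \<Rightarrow> real \<Rightarrow> real" where
  "f_deriv Q K c \<alpha> \<beta> M x =
     (1 / pi) * (\<Sum>i=-int M..int M. \<Sum>k=1..K.
        if x + of_int i \<in> {\<alpha> k..\<beta> k}
        then \<bar>deriv (\<lambda>y. arccos (inverse_branch Q c k (y + of_int i))) x\<bar> else 0)"

end

theory Submission
  imports Defs "HOL-Computational_Algebra.Field_as_Ring"
begin

text \<open>Write \<open>e\<^sup>i\<^sup>\<phi>\<close> for a conjugate of \<open>\<theta>\<close> on the unit circle; the minimal polynomial is then
  \<open>(x\<^sup>2 - (\<theta> + 1/\<theta>) x + 1) (x\<^sup>2 - 2 cos \<phi> x + 1)\<close>, it has integer coefficients, and the traces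
  \<open>\<theta>\<^sup>n + \<theta>\<^sup>-\<^sup>n + 2 cos (n \<phi>)\<close> are integers. Therefore \<open>u n\<close> agrees modulo 1 with
  \<open>Q (cos (n \<phi>))\<close> up to an error tending to 0. Since \<open>e\<^sup>i\<^sup>\<phi>\<close> is not a root of unity, \<open>n \<phi>\<close> is
  equidistributed (Weyl), so \<open>cos (n \<phi>) < z\<close> has density \<open>1 - arccos z / \<pi>\<close>. Cutting \<open>[-1, 1]\<close>
  into the monotonicity intervals of \<open>Q\<close> shows that \<open>Q (cos (n \<phi>)) < y\<close> has density \<open>g y - C\<close> with
  \<open>C\<close> independent of \<open>y\<close>; this is continuous in \<open>y\<close>, which absorbs the error term, and summing over
  the integer parts gives \<open>f\<close>.\<close>

section \<open>Minimal polynomials and traces of Salem numbers\<close>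

lemma map_poly_of_rat_add:
  "map_poly of_rat (p + q) = map_poly of_rat p + (map_poly of_rat q :: 'a::field_char_0 poly)"
  by (rule poly_eqI) (simp add: coeff_map_poly of_rat_add)

lemma map_poly_of_rat_diff:
  "map_poly of_rat (p - q) = map_poly of_rat p - (map_poly of_rat q :: 'a::field_char_0 poly)"
  by (rule poly_eqI) (simp add: coeff_map_poly of_rat_diff)

lemma map_poly_of_rat_mult:
  "map_poly of_rat (p * q) = map_poly of_rat p * (map_poly of_rat q :: 'a::field_char_0 poly)"
  by (rule poly_eqI) (simp add: coeff_map_poly coeff_mult of_rat_sum of_rat_mult)

text \<open>Otherwise \<open>p\<close> and \<open>q\<close> are coprime, and a Bezout combination
  equal to 1 would vanish at \<open>z\<close>.\<close>

lemma irreducible_dvd_of_common_root: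
  fixes p q :: "rat poly" and z :: "'a::field_char_0"
  assumes "irreducible p" and "poly (map_poly of_rat p) z = 0" and "poly (map_poly of_rat q) z = 0"
  shows "p dvd q"
proof (rule ccontr)
  assume "\<not> p dvd q"
  with assms(1) have "coprime p q"
    by (metis irreducible_imp_prime_elem prime_elem_imp_coprime)
  moreover obtain a b where "a * p + b * q = gcd p q"
    using bezout_coefficients_fst_snd by metis
  ultimately have "a * p + b * q = 1" by simp
  then have "poly (map_poly of_rat (a * p + b * q)) z = 1"
    by simp
  then show False
    using assms by (simp add: map_poly_of_rat_add map_poly_of_rat_mult)
qed

text \<open>The uniqueness half of the definite description in \<open>min_poly\<close>: the
  polynomials divide each other, so they differ by a constant factor, which monicity fixes to
  1.\<close>

lemma irreducible_monic_root_unique: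
  fixes p q :: "rat poly" and z :: "'a::field_char_0"
  assumes "irreducible p" "lead_coeff p = 1" "poly (map_poly of_rat p) z = 0"
    and "irreducible q" "lead_coeff q = 1" "poly (map_poly of_rat q) z = 0"
  shows "p = q"
proof -
  have "p dvd q" "q dvd p"
    using assms irreducible_dvd_of_common_root by blast+
  then obtain r s where rs: "q = p * r" "p = q * s" by (metis dvdE)
  have nz: "p \<noteq> 0" "q \<noteq> 0" using assms by auto
  with rs have "degree q = degree p + degree r" "degree p = degree q + degree s"
    by (metis degree_mult_eq mult_eq_0_iff)+
  then have "degree r = 0" by simp
  then obtain c where c: "r = [:c:]" by (rule degree_eq_zeroE)
  with rs(1) assms nz have "c = 1" by (simp split: if_splits)
  with rs(1) c show ?thesis by simp
qed

text \<open>The existence half: a monic annihilator of least degree is irreducible, since in any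
  splitting one factor vanishes at \<open>z\<close> and by minimality carries the whole
  degree.\<close>

lemma ex_irreducible_monic_root:
  fixes F :: "rat poly" and z :: "'a::field_char_0"
  assumes "lead_coeff F = 1" and "poly (map_poly of_rat F) z = 0"
  obtains p :: "rat poly"
  where "irreducible p" "lead_coeff p = 1" "poly (map_poly of_rat p) z = 0"
proof -
  let ?R = "\<lambda>p. lead_coeff p = 1 \<and> poly (map_poly of_rat p) z = 0"
  define p where "p = (ARG_MIN degree p. ?R p)"
  have p: "?R p" and min: "\<And>q. ?R q \<Longrightarrow> degree p \<le> degree q"
    using arg_min_nat_lemma[of ?R F degree] assms unfolding p_def by blast+
  \<comment> \<open>Normalising the leading coefficient extends minimality from monic to all nonzero
    annihilators.\<close>
  have min': "degree p \<le> degree a" if "a \<noteq> 0" "poly (map_poly of_rat a) z = 0" for a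
  proof -
    have "map_poly of_rat (smult c a) = smult (of_rat c) (map_poly of_rat a :: 'a poly)" for c
      by (rule poly_eqI) (simp add: coeff_map_poly of_rat_mult)
    then show ?thesis
      using that min[of "smult (inverse (lead_coeff a)) a"] by simp
  qed
  have "irreducible p"
  proof (rule irreducibleI)
    show "p \<noteq> 0" using p by auto
    show "\<not> p dvd 1"
    proof
      assume "p dvd 1"
      then obtain q where "1 = p * q" ..
      then have "poly (map_poly of_rat (p * q)) z = 1" by (metis map_poly_1' of_rat_1 poly_1)
      with p show False by (simp add: map_poly_of_rat_mult)
    qed
    fix a b assume ab: "p = a * b"
    with p have nz: "a \<noteq> 0" "b \<noteq> 0" by auto
    have "poly (map_poly of_rat a) z = 0 \<or> poly (map_poly of_rat b) z = 0"
      using p ab by (simp add: map_poly_of_rat_mult)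
    moreover have deg: "degree p = degree a + degree b"
      using ab nz by (simp add: degree_mult_eq)
    ultimately have "degree a = 0 \<or> degree b = 0"
      using min'[of a] min'[of b] nz by auto
    then show "a dvd 1 \<or> b dvd 1"
      using nz is_unit_iff_degree by blast
  qed
  with p that show thesis by blast
qed

lemma min_poly_props:
  assumes "lead_coeff F = 1" and "poly (map_poly of_rat F) z = 0"
  shows "irreducible (min_poly z)" "lead_coeff (min_poly z) = 1"
    "poly (map_poly of_rat (min_poly z)) z = 0"
proof -
  obtain p where p: "irreducible p" "lead_coeff p = 1" "poly (map_poly of_rat p) z = 0"
    using ex_irreducible_monic_root[OF assms] .
  have "min_poly z = p"
    unfolding min_poly_def
    by (rule the_equality) (use p irreducible_monic_root_unique in blast)+
  with p show "irreducible (min_poly z)" "lead_coeff (min_poly z) = 1"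
    "poly (map_poly of_rat (min_poly z)) z = 0"
    by auto
qed

section \<open>Gauss's lemma and integral minimal polynomials\<close>

lemma common_denominator_poly:
  fixes p :: "rat poly"
  obtains d :: int and p' :: "int poly" where "d > 0" "smult (of_int d) p = map_poly of_int p'"
proof -
  have "\<exists>d p'. d > (0::int) \<and> smult (of_int d) p = map_poly of_int p'"
  proof (induction p)
    case 0
    show ?case by (rule exI[of _ 1], rule exI[of _ 0]) simp
  next
    case (pCons a p)
    then obtain d p' where dp: "d > 0" "smult (of_int d) p = map_poly of_int p'" by blast
    obtain n e where ne: "a = of_int n / of_int e" "e > 0"
      by (metis quotient_of_div quotient_of_denom_pos surj_pair)
    have "smult (of_int (d * e)) (pCons a p) = map_poly of_int (pCons (d * n) (smult e p'))"
    proof -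
      have "smult (of_int (d * e)) p = smult (of_int e) (smult (of_int d) p)"
        by (simp add: mult.commute)
      also have "\<dots> = map_poly of_int (smult e p')"
        unfolding dp(2) by (rule poly_eqI) (simp add: coeff_map_poly)
      finally show ?thesis
        using ne by (simp add: map_poly_pCons)
    qed
    with dp ne show ?case by (meson mult_pos_pos)
  qed
  with that show thesis by blast
qed

text \<open>Gauss's lemma. With denominators cleared, multiplicativity gives
  \<open>content p' * content q' = d * e\<close>. Each content divides the leading coefficient
  \<open>d\<close> or \<open>e\<close> of its polynomial, so both divisibilities are equalities and
  \<open>d\<close> cancels from \<open>p'\<close>.\<close>

lemma monic_factor_of_int_poly:
  fixes p q :: "rat poly" and F :: "int poly"
  assumes "lead_coeff p = 1" "lead_coeff F = 1" "p * q = map_poly of_int F"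
  shows "coeff p i \<in> \<int>"
proof -
  obtain d p' where d: "d > 0" "smult (of_int d) p = map_poly of_int p'"
    using common_denominator_poly .
  obtain e q' where e: "e > 0" "smult (of_int e) q = map_poly of_int q'"
    using common_denominator_poly .
  have "lead_coeff (p * q) = 1"
    unfolding assms(3) using assms(2) by (simp add: degree_map_poly coeff_map_poly)
  then have lq: "lead_coeff q = 1"
    using assms(1) by (simp add: lead_coeff_mult)
  have lp': "coeff p' (degree p) = d"
    using arg_cong[OF d(2), of "\<lambda>r. coeff r (degree p)"] assms(1) by (simp add: coeff_map_poly)
  have lq': "coeff q' (degree q) = e"
    using arg_cong[OF e(2), of "\<lambda>r. coeff r (degree q)"] lq by (simp add: coeff_map_poly)
  have "map_poly of_int (p' * q') = map_poly of_int p' * (map_poly of_int q' :: rat poly)"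
    by (rule poly_eqI) (simp add: coeff_map_poly coeff_mult)
  also have "\<dots> = smult (of_int (d * e)) (p * q)"
    by (simp flip: d(2) e(2) add: mult.commute)
  also have "\<dots> = map_poly of_int (smult (d * e) F)"
    unfolding assms(3) by (rule poly_eqI) (simp add: coeff_map_poly)
  finally have "coeff (map_poly of_int (p' * q') :: rat poly) j = coeff (map_poly of_int (smult (d * e) F)) j" for j
    by simp
  then have "p' * q' = smult (d * e) F"
    by (intro poly_eqI) (simp add: coeff_map_poly flip: of_int_mult)
  then have "content (p' * q') = d * e * content F"
    using d e by (simp add: abs_mult)
  moreover have "content F = 1"
    using content_dvd_coeff[of F "degree F"] assms(2) 
    by (metis normalize_1_iff normalize_content)
  ultimately have eq: "content p' * content q' = d * e"
    by (simp add: content_mult)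
  have dv: "content p' dvd d" "content q' dvd e"
    using content_dvd_coeff lp' lq' by metis+
  have "d dvd content p'"
  proof -
    from dv obtain x y where xy: "d = content p' * x" "e = content q' * y" by (auto elim!: dvdE)
    from eq xy d e have "x * y = 1"  by auto
    then have "is_unit x" by (metis dvd_triv_left)
    with xy show ?thesis by simp
  qed
  then have "d dvd coeff p' i"
    using content_dvd_coeff dvd_trans by blast
  then obtain k where k: "coeff p' i = d * k" ..
  have "of_int d * coeff p i = (of_int (coeff p' i) :: rat)"
    using arg_cong[OF d(2), of "\<lambda>r. coeff r i"] by (simp add: coeff_map_poly)
  with k d have "coeff p i = of_int k" by simp
  then show ?thesis by simp
qed

lemma min_poly_algebraic_int:
  assumes "algebraic_int z"
  shows "irreducible (min_poly z)" "lead_coeff (min_poly z) = 1"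
    "poly (map_poly of_rat (min_poly z)) z = 0" "coeff (min_poly z) i \<in> \<int>"
proof -
  obtain F where F: "poly (map_poly of_int F) z = 0" "lead_coeff F = 1"
    using assms unfolding algebraic_int_altdef_ipoly by blast
  let ?F = "map_poly of_int F :: rat poly"
  have "lead_coeff ?F = 1" using F(2) by (simp add: degree_map_poly coeff_map_poly)
  moreover have "map_poly of_rat ?F = (map_poly of_int F :: complex poly)"
    by (simp add: map_poly_map_poly o_def)
  ultimately have F': "lead_coeff ?F = 1" "poly (map_poly of_rat ?F) z = 0" using F by auto
  note mp = min_poly_props[OF F']
  show "irreducible (min_poly z)" "lead_coeff (min_poly z) = 1"
    "poly (map_poly of_rat (min_poly z)) z = 0" by fact+
  have "min_poly z dvd ?F"
    using irreducible_dvd_of_common_root mp F' by blast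
  then obtain q where "?F = min_poly z * q" ..
  with monic_factor_of_int_poly[of "min_poly z" F q] mp F show "coeff (min_poly z) i \<in> \<int>"
    by simp
qed

section \<open>Salem numbers of degree 4\<close>

lemma cis_add_cnj: "cis \<phi> + cnj (cis \<phi>) = complex_of_real (2 * cos \<phi>)"
  by (simp add: complex_eq_iff)

text \<open>For a conjugate \<open>w\<close> on the unit circle, \<open>inverse w\<close> is its
  complex conjugate and hence also a root. So \<open>p\<close> divides its reciprocal polynomial,
  \<open>inverse \<theta>\<close> is a root too, and the four distinct roots \<theta>,
  \<open>inverse \<theta>\<close>, \<open>w\<close>, \<open>cnj w\<close> exhaust the
  degree.\<close>

lemma salem_degree_4_min_poly:
  assumes "salem_number \<theta>" and "algebraic_degree (complex_of_real \<theta>) = 4"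
  obtains \<phi> where
    "map_poly of_rat (min_poly (complex_of_real \<theta>)) =
       [:1, - complex_of_real (\<theta> + inverse \<theta>), 1:] * [:1, - complex_of_real (2 * cos \<phi>), 1:]"
    and "\<And>j. j > 0 \<Longrightarrow> cis (real j * \<phi>) \<noteq> 1"
proof -
  define z where "z = complex_of_real \<theta>"
  define p where "p = min_poly z"
  define ev where "ev = (\<lambda>q::rat poly. poly (map_poly of_rat q :: complex poly))"
  have \<theta>: "algebraic_int \<theta>" "\<theta> > 1" using assms(1) unfolding salem_number_def by auto
  then have "algebraic_int z" unfolding z_def by simp
  note mp = min_poly_algebraic_int[OF this, folded p_def]
  have deg: "degree p = 4" using assms(2) by (simp add: algebraic_degree_def p_def z_def)
  obtain w where w: "ev p w = 0" "w \<noteq> z" "norm w = 1"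
    using assms(1) unfolding salem_number_def conjugates_def p_def z_def ev_def by auto
  have dvdI: "p dvd q" if "ev p x = 0" "ev q x = 0" for q x
    using irreducible_dvd_of_common_root mp(1) that unfolding ev_def by blast
  define \<phi> where "\<phi> = Arg w"
  have wphi: "w = cis \<phi>" using w(3) unfolding \<phi>_def
    by (metis cis_Arg norm_zero sgn_eq zero_neq_one div_by_1 of_real_1)
  have cnj_ev: "ev q (cnj x) = cnj (ev q x)" for q x
  proof -
    have "cnj (of_rat c) = of_rat c" for c by (cases c) (simp add: of_rat_rat)
    then show ?thesis unfolding ev_def by (simp add: poly_cnj map_poly_map_poly o_def)
  qed
  have cnjw: "cnj w = inverse w" unfolding wphi by (simp add: cis_cnj cis_inverse)
  have "ev p (inverse w) = 0" using cnj_ev[of p w] w(1) cnjw by simp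
  moreover have ev_reflect: "ev (reflect_poly p) x = x ^ 4 * ev p (inverse x)" if "x \<noteq> 0" for x
  proof -
    have "map_poly of_rat (reflect_poly p) = reflect_poly (map_poly of_rat p :: complex poly)"
      by (rule poly_eqI) (simp add: coeff_map_poly coeff_reflect_poly degree_map_poly)
    with that deg show ?thesis by (simp add: ev_def poly_reflect_poly_nz degree_map_poly)
  qed
  ultimately have "p dvd reflect_poly p"
    using w wphi by (intro dvdI[of w]) auto
  then obtain r where "reflect_poly p = p * r" ..
  then have "ev (reflect_poly p) z = 0" using mp(3) by (simp add: ev_def map_poly_of_rat_mult)
  then have zi: "ev p (inverse z) = 0" using ev_reflect[of z] \<theta> by (simp add: z_def)
  \<comment> \<open>An irreducible polynomial of degree 4 has no rational root; this excludes 1 and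
    -1, the only real candidates for \<open>w\<close>.\<close>
  have rat: "x \<noteq> of_rat c" if "ev p x = 0" for x c
  proof
    assume "x = of_rat c"
    then have "p dvd [:- c, 1:]" by (intro dvdI[OF that]) (simp add: ev_def map_poly_pCons of_rat_minus)
    then have "degree p \<le> degree [:- c, 1:]" by (intro dvd_imp_degree_le) auto
    then show False by (simp add: deg)
  qed
  have "w \<noteq> cnj w"
  proof
    assume "w = cnj w"
    then have "w * w = 1" using cnjw wphi by (metis cis_neq_zero right_inverse)
    then have "w = 1 \<or> w = -1" by (simp add: square_eq_1_iff)
    then show False using rat[OF w(1), of 1] rat[OF w(1), of "-1"] by auto
  qed
  have nz: "norm z > 1" "norm (inverse z) < 1" using \<theta> by (auto simp: z_def norm_inverse inverse_less_1_iff)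
  define A where "A = {z, inverse z, w, cnj w}"
  have "z \<noteq> inverse z" "norm (cnj w) = 1" using nz w(3) by auto
  then have "card A = 4" unfolding A_def using \<open>w \<noteq> cnj w\<close> w(3) nz
    by (subst card_insert_disjoint; auto)+
  let ?q = "[:1, - complex_of_real (\<theta> + inverse \<theta>), 1:] * [:1, - complex_of_real (2 * cos \<phi>), 1:]"
  have qf: "poly ?q x = (x - z) * (x - inverse z) * ((x - w) * (x - cnj w))" for x
  proof -
    have "poly [:1, - complex_of_real (\<theta> + inverse \<theta>), 1:] x = (x - z) * (x - inverse z)"
      using \<theta> by (simp add: z_def algebra_simps)
    moreover have "poly [:1, - complex_of_real (2 * cos \<phi>), 1:] x = (x - w) * (x - cnj w)"
    proof -
      have "w * cnj w = 1" using cnjw wphi by (metis cis_neq_zero right_inverse)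
      moreover have "complex_of_real (2 * cos \<phi>) = w + cnj w" unfolding wphi
        by (rule cis_add_cnj[symmetric])
      ultimately show ?thesis by (simp add: algebra_simps)
    qed
    ultimately show ?thesis by (simp only: poly_mult)
  qed
  \<comment> \<open>Both sides have degree at most 4 and the same coefficient of x^4, so agreement
    at four points suffices.\<close>
  have eq: "map_poly of_rat p = ?q"
  proof (rule poly_eqI_degree_lead_coeff[where A = A and n = 4])
    show "coeff (map_poly of_rat p) 4 = coeff ?q 4"
      using mp(2) deg by (simp add: coeff_map_poly eval_nat_numeral)
    show "4 \<le> card A" using \<open>card A = 4\<close> by simp
    show "degree (map_poly of_rat p :: complex poly) \<le> 4" using deg by (simp add: degree_map_poly)
    show "degree ?q \<le> 4" by (rule order.trans[OF degree_mult_le]) simp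
    fix x assume "x \<in> A"
    then have "ev p x = 0" using mp(3) w(1) zi cnj_ev[of p w] by (auto simp: A_def ev_def)
    moreover have "poly ?q x = 0" unfolding qf using \<open>x \<in> A\<close> by (auto simp: A_def)
    ultimately show "poly (map_poly of_rat p) x = poly ?q x" by (simp add: ev_def)
  qed
  \<comment> \<open>If \<open>w\<close> were a root of unity, \<open>p\<close> would divide x^j - 1,
    and its root \<theta> > 1 would satisfy \<theta>^j = 1.\<close>
  have "cis (real j * \<phi>) \<noteq> 1" if "j > 0" for j
  proof
    assume "cis (real j * \<phi>) = 1"
    then have "w ^ j = 1" by (simp add: wphi Complex.DeMoivre)
    then have "p dvd (monom 1 j - 1)"
      by (intro dvdI[OF w(1)]) (simp add: ev_def map_poly_of_rat_diff map_poly_monom poly_monom)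
    then obtain r where "monom 1 j - 1 = p * r" ..
    then have "ev (monom 1 j - 1) z = 0" using mp(3) by (simp add: ev_def map_poly_of_rat_mult)
    then have "z ^ j = 1" by (simp add: ev_def map_poly_of_rat_diff map_poly_monom poly_monom)
    then have "norm z ^ j = 1" by (metis norm_one norm_power)
    with nz that show False by (metis one_less_power less_irrefl)
  qed
  with eq show thesis using that unfolding p_def z_def by blast
qed

text \<open>These are the power sums of the four conjugates. They obey the linear recurrence whose
  characteristic polynomial is the minimal polynomial, so integrality follows from four integral
  initial values.\<close>

lemma salem_degree_4_trace:
  assumes "salem_number \<theta>" and "algebraic_degree (complex_of_real \<theta>) = 4"
  obtains \<phi> where "\<And>n. \<theta> ^ n + inverse \<theta> ^ n + 2 * cos (real n * \<phi>) \<in> \<int>"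
    and "\<And>j. j > 0 \<Longrightarrow> cis (real j * \<phi>) \<noteq> 1"
proof -
  obtain \<phi> where mp: "map_poly of_rat (min_poly (complex_of_real \<theta>)) =
       [:1, - complex_of_real (\<theta> + inverse \<theta>), 1:] * [:1, - complex_of_real (2 * cos \<phi>), 1:]"
    and aper: "\<And>j. j > 0 \<Longrightarrow> cis (real j * \<phi>) \<noteq> 1"
    using salem_degree_4_min_poly[OF assms] by blast
  have \<theta>: "algebraic_int \<theta>" "\<theta> > 1" using assms(1) unfolding salem_number_def by auto
  have int: "coeff (map_poly of_rat (min_poly (complex_of_real \<theta>))) i \<in> (\<int> :: complex set)" for i
    using min_poly_algebraic_int(4)[of "complex_of_real \<theta>" i] \<theta>(1)
    by (auto simp: coeff_map_poly elim!: Ints_cases)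
  \<comment> \<open>The traces of the two quadratic factors. The coefficients of the product yield
    integrality of \<open>a + b\<close> and \<open>a * b\<close>.\<close>
  define a b where "a = \<theta> + inverse \<theta>" and "b = 2 * cos \<phi>"
  have "complex_of_real (- (a + b)) = coeff (map_poly of_rat (min_poly (complex_of_real \<theta>))) 3"
    "complex_of_real (a * b + 2) = coeff (map_poly of_rat (min_poly (complex_of_real \<theta>))) 2"
    unfolding mp a_def b_def by (simp_all add: eval_nat_numeral algebra_simps)
  with int have "- (a + b) \<in> \<int>" and ab2: "a * b + 2 \<in> \<int>"
    by (metis of_real_in_Ints_iff)+
  then have ab: "a + b \<in> \<int>" "a * b + 2 \<in> \<int>"
    using Ints_minus[of "- (a + b)"] by (simp_all add: add.commute)
  then have abi: "a * b \<in> \<int>" using Ints_diff[of "a * b + 2" 2] by simp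
  define s t where "s n = \<theta> ^ n + inverse \<theta> ^ n" and "t n = 2 * cos (real n * \<phi>)" for n
  have srec: "s (n + 2) = a * s (n + 1) - s n" for n
  proof -
    have "a * s (n + 1) = \<theta> ^ (n + 2) + inverse \<theta> ^ (n + 2) + (\<theta> * inverse \<theta>) * s n"
      by (simp add: s_def a_def ring_distribs)
    then show ?thesis using \<theta>(2) by (simp add: s_def)
  qed
  have trec: "t (n + 2) = b * t (n + 1) - t n" for n
  proof -
    have "cos (real (n + 2) * \<phi>) + cos (real n * \<phi>) = 2 * cos \<phi> * cos (real (n + 1) * \<phi>)"
      using cos_add[of "real (n + 1) * \<phi>" \<phi>] cos_diff[of "real (n + 1) * \<phi>" \<phi>]
      by (simp add: algebra_simps)
    then show ?thesis by (simp add: t_def b_def)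
  qed
  have init: "s 0 = 2" "t 0 = 2" "s 1 = a" "t 1 = b"
    by (simp_all add: s_def t_def a_def b_def)
  define u where "u n = s n + t n" for n
  \<comment> \<open>The characteristic polynomial (x^2 - a x + 1) (x^2 - b x + 1) has coefficients
    symmetric in \<open>a\<close> and \<open>b\<close>.\<close>
  have urec: "u (n + 4) = (a + b) * u (n + 3) - (a * b + 2) * u (n + 2) + (a + b) * u (n + 1) - u n" for n
  proof -
    have rec: "s (n + 3) = a * s (n + 2) - s (n + 1)" "s (n + 4) = a * s (n + 3) - s (n + 2)"
      "t (n + 3) = b * t (n + 2) - t (n + 1)" "t (n + 4) = b * t (n + 3) - t (n + 2)"
      using srec[of "n + 1"] srec[of "n + 2"] trec[of "n + 1"] trec[of "n + 2"]
      by (simp_all add: numeral_eq_Suc)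
    show ?thesis
      unfolding u_def rec srec trec by (simp add: algebra_simps)
  qed
  have s23: "s 2 = a * a - 2" "s 3 = a * s 2 - a" and t23: "t 2 = b * b - 2" "t 3 = b * t 2 - b"
    using srec[of 0] trec[of 0] srec[of 1] trec[of 1] init by (simp_all add: numeral_eq_Suc)
  \<comment> \<open>The remaining initial values, written through \<open>a + b\<close> and
    \<open>a * b\<close> as in Newton's identities.\<close>
  have u2: "u 2 = (a + b)^2 - 2 * (a * b) - 4"
    unfolding u_def s23 t23 by (simp add: algebra_simps power2_eq_square)
  have u3: "u 3 = (a + b)^3 - 3 * (a * b) * (a + b) - 3 * (a + b)"
    unfolding u_def s23 t23 by (simp add: algebra_simps power3_eq_cube)
  have u3': "u 3 \<in> \<int>"
    unfolding u3 using ab abi by (blast intro: Ints_diff Ints_mult Ints_power Ints_numeral)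
  have "u n \<in> \<int>" for n
  proof (induction n rule: less_induct)
    case (less n)
    have "n = 0 \<or> n = 1 \<or> n = 2 \<or> n = 3 \<or> (\<exists>k. n = k + 4)" by presburger
    then consider "n = 0" | "n = 1" | "n = 2" | "n = 3" | k where "n = k + 4" by blast
    then show ?case
    proof cases
      case 5
      have "u k \<in> \<int>" "u (k + 1) \<in> \<int>" "u (k + 2) \<in> \<int>" "u (k + 3) \<in> \<int>"
        using less 5 by auto
      then show ?thesis unfolding 5 urec using ab by (blast intro: Ints_add Ints_diff Ints_mult)
    qed (use u2 u3' ab abi init in \<open>auto simp: u_def\<close>)
  qed
  then show thesis using that aper unfolding u_def s_def t_def by blast
qed

section \<open>Mean values and equidistribution of cosines\<close>

text \<open>The Cesaro mean. For an indicator \<open>of_bool\<close> it is the natural density,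
  which turns counting into linear statements about sequences.\<close>

definition has_mean :: "(nat \<Rightarrow> real) \<Rightarrow> real \<Rightarrow> bool" where
  "has_mean h d \<longleftrightarrow> (\<lambda>N. (\<Sum>n<N. h n) / real N) \<longlonglongrightarrow> d"

lemma has_mean_add: "has_mean f a \<Longrightarrow> has_mean g b \<Longrightarrow> has_mean (\<lambda>n. f n + g n) (a + b)"
  unfolding has_mean_def by (simp add: sum.distrib add_divide_distrib tendsto_add)

lemma has_mean_cmult: "has_mean f a \<Longrightarrow> has_mean (\<lambda>n. c * f n) (c * a)"
  unfolding has_mean_def by (simp flip: sum_distrib_left times_divide_eq_right add: tendsto_mult_left)

lemma has_mean_minus: "has_mean f a \<Longrightarrow> has_mean (\<lambda>n. - f n) (- a)"
  using has_mean_cmult[of f a "- 1"] by simp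

lemma has_mean_diff: "has_mean f a \<Longrightarrow> has_mean g b \<Longrightarrow> has_mean (\<lambda>n. f n - g n) (a - b)"
  using has_mean_add[OF _ has_mean_minus] by fastforce

lemma has_mean_const: "has_mean (\<lambda>n. c) c"
  unfolding has_mean_def
  \<comment> \<open>Division by zero makes the quotient 0 at N = 0; it equals \<open>c\<close> from
    N = 1 on.\<close>
  by (rule tendsto_eventually, rule eventually_sequentiallyI[of 1]) simp

lemma has_mean_sum:
  "(\<And>i. i \<in> A \<Longrightarrow> has_mean (f i) (a i)) \<Longrightarrow> has_mean (\<lambda>n. \<Sum>i\<in>A. f i n) (\<Sum>i\<in>A. a i)"
  by (induction A rule: infinite_finite_induct)
    (auto intro: has_mean_add has_mean_const[of 0])

lemma has_mean_unique: "has_mean f a \<Longrightarrow> has_mean f b \<Longrightarrow> a = b"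
  unfolding has_mean_def by (rule LIMSEQ_unique)

text \<open>The finitely many indices violating the comparison contribute a bounded amount, which
  vanishes after division by N.\<close>

lemma has_mean_lower_bound:
  assumes f: "has_mean f a" and le: "\<forall>\<^sub>F n in sequentially. f n \<le> h n" and "x < a"
  shows "\<forall>\<^sub>F N in sequentially. x < (\<Sum>n<N. h n) / real N"
proof -
  from le obtain n0 where n0: "\<And>n. n \<ge> n0 \<Longrightarrow> f n \<le> h n"
    unfolding eventually_sequentially by blast
  define c where "c = (\<Sum>n<n0. h n - f n)"
  have "(\<lambda>N. (\<Sum>n<N. f n) / real N + c / real N) \<longlonglongrightarrow> a + 0"
    using f unfolding has_mean_def by (intro tendsto_add lim_const_over_n)
  then have "\<forall>\<^sub>F N in sequentially. x < (\<Sum>n<N. f n) / real N + c / real N"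
    using \<open>x < a\<close> by (intro order_tendstoD) auto
  with eventually_ge_at_top[of n0] show ?thesis
  proof eventually_elim
    case (elim N)
    have "c \<le> (\<Sum>n<N. h n - f n)"
      unfolding c_def using elim n0 by (intro sum_mono2) auto
    then have "((\<Sum>n<N. f n) + c) / real N \<le> (\<Sum>n<N. h n) / real N"
      by (intro divide_right_mono) (simp_all add: sum_subtractf)
    with elim show ?case by (simp add: add_divide_distrib)
  qed
qed

text \<open>The common tool for the limit passages below: polynomial approximation, ramps and the
  vanishing error. Upper bounds are lower bounds for the negated sequence.\<close>

lemma has_mean_squeeze:
  assumes lower: "\<And>e. e > 0 \<Longrightarrow> \<exists>f a. has_mean f a \<and> (\<forall>\<^sub>F n in sequentially. f n \<le> h n) \<and> d - e \<le> a"
    and upper: "\<And>e. e > 0 \<Longrightarrow> \<exists>g b. has_mean g b \<and> (\<forall>\<^sub>F n in sequentially. h n \<le> g n) \<and> b \<le> d + e"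
  shows "has_mean h d"
  unfolding has_mean_def
proof (rule order_tendstoI)
  fix x assume "x < d"
  with lower[of "(d - x) / 2"] obtain f a where
    "has_mean f a" "\<forall>\<^sub>F n in sequentially. f n \<le> h n" "d - (d - x) / 2 \<le> a"
    by auto
  with \<open>x < d\<close> show "\<forall>\<^sub>F N in sequentially. x < (\<Sum>n<N. h n) / real N"
    by (intro has_mean_lower_bound[of f a]) (auto simp: field_simps)
next
  fix x assume "x > d"
  with upper[of "(x - d) / 2"] obtain g b where
    "has_mean g b" "\<forall>\<^sub>F n in sequentially. h n \<le> g n" "b \<le> d + (x - d) / 2"
    by auto
  with \<open>x > d\<close> have "\<forall>\<^sub>F N in sequentially. - x < (\<Sum>n<N. - h n) / real N"
    by (intro has_mean_lower_bound[OF has_mean_minus[of g b]]) (auto simp: field_simps)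
  then show "\<forall>\<^sub>F N in sequentially. (\<Sum>n<N. h n) / real N < x"
    by eventually_elim (simp add: sum_negf)
qed

lemma has_mean_between:
  assumes "has_mean f d" "has_mean g d" "\<And>n. f n \<le> h n" "\<And>n. h n \<le> g n"
  shows "has_mean h d"
  by (rule has_mean_squeeze) (use assms in \<open>force intro!: always_eventually\<close>)+

text \<open>The partial sums are real parts of geometric sums with ratio \<open>cis \<psi>\<close>,
  hence bounded independently of N.\<close>

lemma has_mean_cos:
  assumes "cis \<psi> \<noteq> 1"
  shows "has_mean (\<lambda>n. cos (real n * \<psi>)) 0"
proof -
  define K where "K = 2 / norm (cis \<psi> - 1)"
  have bound: "\<bar>\<Sum>n<N. cos (real n * \<psi>)\<bar> \<le> K" for N
  proof -
    have "(\<Sum>n<N. cos (real n * \<psi>)) = Re (\<Sum>n<N. cis \<psi> ^ n)"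
      by (simp add: Complex.DeMoivre)
    also have "\<bar>\<dots>\<bar> \<le> norm (\<Sum>n<N. cis \<psi> ^ n)" by (rule abs_Re_le_cmod)
    also have "(\<Sum>n<N. cis \<psi> ^ n) = (cis \<psi> ^ N - 1) / (cis \<psi> - 1)"
      using assms by (rule geometric_sum)
    also have "norm \<dots> \<le> K"
      unfolding K_def norm_divide
      by (intro divide_right_mono) (use norm_triangle_ineq4[of "cis \<psi> ^ N" 1] in \<open>auto simp: norm_power\<close>)
    finally show ?thesis .
  qed
  show ?thesis
    unfolding has_mean_def
  proof (rule Lim_null_comparison)
    show "\<forall>\<^sub>F N in sequentially. norm ((\<Sum>n<N. cos (real n * \<psi>)) / real N) \<le> K / real N"
      using bound by (auto intro!: always_eventually divide_right_mono)
    show "(\<lambda>N. K / real N) \<longlonglongrightarrow> 0" by (rule lim_const_over_n)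
  qed
qed

section \<open>Weyl equidistribution for \<phi> an irrational multiple of 2 pi\<close>

locale equidistributed_angle =
  fixes \<phi> :: real
  assumes aperiodic: "j > 0 \<Longrightarrow> cis (real j * \<phi>) \<noteq> 1"
begin

text \<open>The extra factor \<open>cos (j t)\<close> makes the induction on \<open>i\<close> work:
  \<open>2 cos t cos (j t) = cos ((j + 1) t) + cos ((j - 1) t)\<close>.\<close>

lemma mean_cos_power_mult_cos:
  fixes j :: int
  shows "\<exists>I. has_mean (\<lambda>n. cos (real n * \<phi>) ^ i * cos (of_int j * (real n * \<phi>))) I \<and>
             ((\<lambda>t. cos t ^ i * cos (of_int j * t)) has_integral (pi * I)) {0..pi}"
proof (induction i arbitrary: j)
  case 0
  show ?case
  proof (cases "j = 0")
    case True
    then show ?thesis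
      using has_mean_const[of 1] has_integral_const_real[of "1::real" 0 pi]
      by (intro exI[of _ 1]) simp
  next
    case False
    have "cis (of_int j * \<phi>) \<noteq> 1"
    proof (cases "j > 0")
      case True
      with aperiodic[of "nat j"] show ?thesis by simp
    next
      case neg: False
      have "cis (of_int j * \<phi>) = inverse (cis (real (nat (- j)) * \<phi>))"
        using neg by (simp add: cis_inverse)
      with aperiodic[of "nat (- j)"] neg \<open>j \<noteq> 0\<close> show ?thesis
        by (metis inverse_eq_1_iff linorder_neqE_linordered_idom neg_0_less_iff_less zero_less_nat_eq)
    qed
    then have "has_mean (\<lambda>n. cos (of_int j * (real n * \<phi>))) 0"
      using has_mean_cos[of "of_int j * \<phi>"] by (simp add: mult_ac)
    moreover have "((\<lambda>t. cos (of_int j * t)) has_integral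
        (sin (of_int j * pi) / of_int j - sin (of_int j * 0) / of_int j)) {0..pi}"
      using False
      by (intro fundamental_theorem_of_calculus)
        (auto intro!: derivative_eq_intros simp flip: has_real_derivative_iff_has_vector_derivative)
    moreover have "sin (of_int j * pi) = 0"
      by (simp add: sin_integer_2pi sin_zero_iff_int2 )
    ultimately show ?thesis by (intro exI[of _ 0]) simp
  qed
next
  case (Suc i)
  obtain I1 where I1: "has_mean (\<lambda>n. cos (real n * \<phi>) ^ i * cos (of_int (j + 1) * (real n * \<phi>))) I1"
    "((\<lambda>t. cos t ^ i * cos (of_int (j + 1) * t)) has_integral (pi * I1)) {0..pi}"
    using Suc by blast
  obtain I2 where I2: "has_mean (\<lambda>n. cos (real n * \<phi>) ^ i * cos (of_int (j - 1) * (real n * \<phi>))) I2"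
    "((\<lambda>t. cos t ^ i * cos (of_int (j - 1) * t)) has_integral (pi * I2)) {0..pi}"
    using Suc by blast
  have eq: "cos t ^ Suc i * cos (of_int j * t) =
      1/2 * (cos t ^ i * cos (of_int (j + 1) * t) + cos t ^ i * cos (of_int (j - 1) * t))" for t :: real
  proof -
    have "cos (of_int (j + 1) * t) + cos (of_int (j - 1) * t) = 2 * cos t * cos (of_int j * t)"
      using cos_add[of "of_int j * t" t] cos_diff[of "of_int j * t" t] by (simp add: algebra_simps)
    then show ?thesis by (simp flip: distrib_left)
  qed
  have "has_mean (\<lambda>n. cos (real n * \<phi>) ^ Suc i * cos (of_int j * (real n * \<phi>))) (1/2 * (I1 + I2))"
    unfolding eq by (intro has_mean_cmult has_mean_add I1 I2)
  moreover have "((\<lambda>t. cos t ^ Suc i * cos (of_int j * t)) has_integral (1/2 * (pi * I1 + pi * I2))) {0..pi}"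
    unfolding eq by (intro has_integral_mult_right has_integral_add I1 I2)
  moreover have "1/2 * (pi * I1 + pi * I2) = pi * (1/2 * (I1 + I2))" by (simp add: algebra_simps)
  ultimately show ?case by (intro exI[of _ "1/2 * (I1 + I2)"]) (simp only: simp_thms)
qed

text \<open>By linearity from the monomials, the case j = 0 above. Here \<open>I\<close> is the
  average over [0, pi], a half period on which the cosine takes each of its values once.\<close>

lemma mean_polynomial_cos:
  assumes "real_polynomial_function R"
  shows "\<exists>I. has_mean (\<lambda>n. R (cos (real n * \<phi>))) I \<and> ((\<lambda>t. R (cos t)) has_integral (pi * I)) {0..pi}"
proof -
  obtain a k where R: "R = (\<lambda>x. \<Sum>i\<le>k. a i * x ^ i)"
    using assms real_polynomial_function_iff_sum by blast
  have "\<forall>i. \<exists>I. has_mean (\<lambda>n. cos (real n * \<phi>) ^ i) I \<and> ((\<lambda>t. cos t ^ i) has_integral (pi * I)) {0..pi}"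
    using mean_cos_power_mult_cos[of _ 0] by simp
  then obtain I where I: "\<And>i. has_mean (\<lambda>n. cos (real n * \<phi>) ^ i) (I i)"
    "\<And>i. ((\<lambda>t. cos t ^ i) has_integral (pi * I i)) {0..pi}"
    by metis
  have "has_mean (\<lambda>n. R (cos (real n * \<phi>))) (\<Sum>i\<le>k. a i * I i)"
    unfolding R by (intro has_mean_sum has_mean_cmult I)
  moreover have "((\<lambda>t. R (cos t)) has_integral (\<Sum>i\<le>k. a i * (pi * I i))) {0..pi}"
    unfolding R by (intro has_integral_sum has_integral_mult_right I) simp
  ultimately show ?thesis
    by (intro exI[of _ "\<Sum>i\<le>k. a i * I i"]) (simp add: sum_distrib_left mult_ac)
qed

text \<open>Weyl's theorem for continuous functions of the cosine: replacing \<open>h\<close> by a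
  polynomial within \<open>e\<close> of it on [-1, 1] changes the terms and the average over [0, pi]
  by at most \<open>e\<close>.\<close>

lemma mean_continuous_cos:
  assumes h: "continuous_on {-1..1} h"
  shows "has_mean (\<lambda>n. h (cos (real n * \<phi>))) (integral {0..pi} (\<lambda>t. h (cos t)) / pi)"
proof -
  have int: "(\<lambda>t. h (cos t)) integrable_on {0..pi}"
    by (intro integrable_continuous_real continuous_on_compose2[OF h]) (auto intro!: continuous_intros)
  have approx: "\<exists>R I. has_mean R I \<and> (\<forall>n. \<bar>h (cos (real n * \<phi>)) - R n\<bar> \<le> e) \<and>
      \<bar>I - integral {0..pi} (\<lambda>t. h (cos t)) / pi\<bar> \<le> e" if "e > 0" for e
  proof -
    obtain R where R: "real_polynomial_function R" "\<And>x. x \<in> {-1..1} \<Longrightarrow> \<bar>h x - R x\<bar> < e"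
      using Stone_Weierstrass_real_polynomial_function[of "{-1..1}" h e] h \<open>e > 0\<close> by auto
    obtain I where I: "has_mean (\<lambda>n. R (cos (real n * \<phi>))) I"
      "((\<lambda>t. R (cos t)) has_integral (pi * I)) {0..pi}"
      using mean_polynomial_cos[OF R(1)] by blast
    have "norm (integral {0..pi} (\<lambda>t. h (cos t)) - pi * I) \<le> e * Henstock_Kurzweil_Integration.content {0..pi}"
    proof (rule has_integral_bound_real)
      show "((\<lambda>t. h (cos t) - R (cos t)) has_integral integral {0..pi} (\<lambda>t. h (cos t)) - pi * I) {0..pi}"
        by (intro has_integral_diff I(2) integrable_integral int)
    qed (use R(2) \<open>e > 0\<close> in \<open>auto intro!: less_imp_le\<close>)
    then have "\<bar>integral {0..pi} (\<lambda>t. h (cos t)) - pi * I\<bar> \<le> e * pi" by simp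
    then have "\<bar>I - integral {0..pi} (\<lambda>t. h (cos t)) / pi\<bar> \<le> e"
      by (simp add: abs_le_iff field_simps)
    with I(1) R(2) show ?thesis by (meson atLeastAtMost_iff cos_ge_minus_one cos_le_one less_imp_le)
  qed
  show ?thesis (is "has_mean _ ?d")
  proof (rule has_mean_squeeze)
    fix e :: real assume "e > 0"
    then obtain R I where RI: "has_mean R I" "\<forall>n. \<bar>h (cos (real n * \<phi>)) - R n\<bar> \<le> e/2" "\<bar>I - ?d\<bar> \<le> e/2"
      using approx[of "e/2"] by auto
    have "R n - e/2 \<le> h (cos (real n * \<phi>))" "h (cos (real n * \<phi>)) \<le> R n + e/2" for n
      using RI(2)[rule_format, of n] unfolding abs_le_iff by linarith+
    moreover have "?d - e \<le> I - e/2" "I + e/2 \<le> ?d + e"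
      using RI(3) unfolding abs_le_iff by linarith+
    moreover have "has_mean (\<lambda>n. R n - e/2) (I - e/2)" "has_mean (\<lambda>n. R n + e/2) (I + e/2)"
      by (intro has_mean_add has_mean_diff RI(1) has_mean_const)+
    ultimately show "\<exists>f a. has_mean f a \<and> (\<forall>\<^sub>F n in sequentially. f n \<le> h (cos (real n * \<phi>))) \<and> ?d - e \<le> a"
      and "\<exists>f a. has_mean f a \<and> (\<forall>\<^sub>F n in sequentially. h (cos (real n * \<phi>)) \<le> f n) \<and> a \<le> ?d + e"
      by (meson always_eventually)+
  qed
qed

text \<open>A continuous substitute for an indicator: 1 up to \<open>a\<close>, 0 from
  \<open>b\<close> on, linear between. Since the cosine decreases on [0, pi], its values up to
  \<open>a\<close> and up to \<open>b\<close> fill the fractions \<open>1 - arccos a / pi\<close>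
  and \<open>1 - arccos b / pi\<close>, which enclose the mean of the ramp.\<close>

lemma mean_ramp:
  fixes a b :: real
  assumes "a < b"
  shows "\<exists>I. has_mean (\<lambda>n. max 0 (min 1 ((b - cos (real n * \<phi>)) / (b - a)))) I \<and>
    (-1 \<le> a \<and> a \<le> 1 \<longrightarrow> 1 - arccos a / pi \<le> I) \<and> (-1 \<le> b \<and> b \<le> 1 \<longrightarrow> I \<le> 1 - arccos b / pi)"
proof -
  define r where "r v = max 0 (min 1 ((b - v) / (b - a)))" for v :: real
  define I where "I = integral {0..pi} (\<lambda>t. r (cos t)) / pi"
  have cont: "continuous_on S r" for S
    unfolding r_def by (intro continuous_intros) (use assms in auto)
  have "has_mean (\<lambda>n. r (cos (real n * \<phi>))) I"
    unfolding I_def by (rule mean_continuous_cos) (rule cont)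
  have int: "((\<lambda>t. r (cos t)) has_integral (pi * I)) {0..pi}"
    unfolding I_def
    by (auto intro!: integrable_integral integrable_continuous_real continuous_on_compose2[OF cont]
        continuous_intros)
  have step: "((\<lambda>t. if t \<in> {s..pi} then 1 else 0) has_integral (pi - s)) {0..pi}" if "0 \<le> s" "s \<le> pi" for s :: real
    using that has_integral_const_real[of "1::real" s pi]
    by (subst has_integral_restrict) auto
  have "1 - arccos a / pi \<le> I" if le: "-1 \<le> a" "a \<le> 1"
  proof -
    have "(if t \<in> {arccos a..pi} then 1 else 0) \<le> r (cos t)" if t: "t \<in> {0..pi}" for t
    proof (cases "arccos a \<le> t")
      case True
      then have "cos t \<le> cos (arccos a)"
        using t le by (intro cos_monotone_0_pi_le) (auto intro: arccos_lbound)
      then have "(b - cos t) / (b - a) \<ge> 1" using assms le by (simp add: field_simps)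
      then show ?thesis by (simp add: r_def)
    qed (simp add: r_def)
    then have "pi - arccos a \<le> pi * I"
      using arccos_lbound[of a] arccos_ubound[of a] le
      by (intro has_integral_le[OF step int]) auto
    then show ?thesis by (simp add: field_simps)
  qed
  moreover have "I \<le> 1 - arccos b / pi" if le: "-1 \<le> b" "b \<le> 1"
  proof -
    have "r (cos t) \<le> (if t \<in> {arccos b..pi} then 1 else 0)" if t: "t \<in> {0..pi}" for t
    proof (cases "arccos b \<le> t")
      case False
      then have "cos (arccos b) \<le> cos t"
        using t le by (intro cos_monotone_0_pi_le) (auto intro: arccos_ubound)
      then have "(b - cos t) / (b - a) \<le> 0" using assms le by (simp add: divide_le_0_iff)
      then show ?thesis using False by (simp add: r_def)
    qed (use t in \<open>simp add: r_def\<close>)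
    then have "pi * I \<le> pi - arccos b"
      using arccos_lbound[of b] arccos_ubound[of b] le
      by (intro has_integral_le[OF int step]) auto
    then show ?thesis by (simp add: field_simps)
  qed
  ultimately show ?thesis
    using \<open>has_mean (\<lambda>n. r (cos (real n * \<phi>))) I\<close> unfolding r_def by blast
qed

text \<open>Sandwiching \<open>h\<close> covers both \<open><\<close> and \<open>\<le>\<close>, hence also that single values have density zero.\<close>

lemma mean_cos_below:
  assumes z: "-1 \<le> z" "z \<le> 1"
    and lower: "\<And>n. of_bool (cos (real n * \<phi>) < z) \<le> h n"
    and upper: "\<And>n. h n \<le> of_bool (cos (real n * \<phi>) \<le> z)"
  shows "has_mean h (1 - arccos z / pi)"
proof -
  have cont: "\<exists>\<delta>>0. \<forall>x\<in>{-1..1}. \<bar>x - z\<bar> < \<delta> \<longrightarrow> \<bar>arccos x - arccos z\<bar> < e * pi" if "e > 0" for e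
    using continuous_on_arccos'[unfolded continuous_on_iff, rule_format, of z "e * pi"] z that
    by (auto simp: dist_real_def)
  show ?thesis
  proof (rule has_mean_squeeze)
    fix e :: real assume "e > 0"
    then obtain \<delta> where \<delta>: "\<delta> > 0" "\<And>x. x \<in> {-1..1} \<Longrightarrow> \<bar>x - z\<bar> < \<delta> \<Longrightarrow> \<bar>arccos x - arccos z\<bar> < e * pi"
      using cont by blast
    show "\<exists>f a. has_mean f a \<and> (\<forall>\<^sub>F n in sequentially. f n \<le> h n) \<and> 1 - arccos z / pi - e \<le> a"
    proof (cases "z = -1")
      \<comment> \<open>At z = -1 no ramp fits to the left within [-1, 1]; the target density is 0
        there and the zero sequence is the minorant.\<close>
      case True
      have "0 \<le> h n" for n using lower[of n] by (auto intro: order.trans[rotated])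
      with True \<open>e > 0\<close> show ?thesis
        by (intro exI[of _ "\<lambda>n. 0"] exI[of _ 0]) (auto simp: has_mean_const)
    next
      case False
      define a where "a = max (-1) (z - \<delta> / 2)"
      have a: "a < z" "-1 \<le> a" "a \<le> 1" "\<bar>a - z\<bar> < \<delta>"
        using \<delta>(1) z False by (auto simp: a_def)
      obtain I where I: "has_mean (\<lambda>n. max 0 (min 1 ((z - cos (real n * \<phi>)) / (z - a)))) I"
        "1 - arccos a / pi \<le> I"
        using mean_ramp[OF a(1)] a by auto
      have "max 0 (min 1 ((z - cos (real n * \<phi>)) / (z - a))) \<le> h n" for n
      proof -
        have "max 0 (min 1 ((z - cos (real n * \<phi>)) / (z - a))) \<le> of_bool (cos (real n * \<phi>) < z)"
          using a(1) by (auto simp: divide_le_0_iff)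
        with lower[of n] show ?thesis by linarith
      qed
      moreover have "1 - arccos z / pi - e \<le> I"
        using \<delta>(2)[of a] a I(2) by (simp add: field_simps abs_less_iff)
      ultimately show ?thesis using I(1) by (meson always_eventually)
    qed
    show "\<exists>f a. has_mean f a \<and> (\<forall>\<^sub>F n in sequentially. h n \<le> f n) \<and> a \<le> 1 - arccos z / pi + e"
    proof (cases "z = 1")
      case True
      have "h n \<le> 1" for n using upper[of n] by (auto intro: order.trans)
      with True \<open>e > 0\<close> show ?thesis
        by (intro exI[of _ "\<lambda>n. 1"] exI[of _ 1]) (auto simp: has_mean_const)
    next
      case False
      define b where "b = min 1 (z + \<delta> / 2)"
      have b: "z < b" "-1 \<le> b" "b \<le> 1" "\<bar>b - z\<bar> < \<delta>"
        using \<delta>(1) z False by (auto simp: b_def)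
      obtain I where I: "has_mean (\<lambda>n. max 0 (min 1 ((b - cos (real n * \<phi>)) / (b - z)))) I"
        "I \<le> 1 - arccos b / pi"
        using mean_ramp[OF b(1)] b by auto
      have "h n \<le> max 0 (min 1 ((b - cos (real n * \<phi>)) / (b - z)))" for n
      proof -
        have "of_bool (cos (real n * \<phi>) \<le> z) \<le> max 0 (min 1 ((b - cos (real n * \<phi>)) / (b - z)))"
          using b(1) by (auto simp: le_max_iff_disj)
        with upper[of n] show ?thesis by linarith
      qed
      moreover have "I \<le> 1 - arccos z / pi + e"
        using \<delta>(2)[of b] b I(2) by (simp add: field_simps abs_less_iff)
      ultimately show ?thesis using I(1) by (meson always_eventually)
    qed
  qed
qed

end

section \<open>Monotone branches\<close>

text \<open>The derivative may vanish at the endpoints, as it does at inner partition points;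
  continuity carries strictness up to them.\<close>

lemma strict_mono_on_polyI:
  fixes Q :: "real poly"
  assumes "\<forall>x\<in>{a<..<b}. poly (pderiv Q) x > 0"
  shows "strict_mono_on {a..b} (poly Q)"
proof (rule monotone_onI)
  fix x y assume "x \<in> {a..b}" "y \<in> {a..b}" "x < y"
  with assms show "poly Q x < poly Q y"
    by (intro DERIV_pos_imp_increasing_open[of x y "poly Q"])
      (auto intro!: exI[of _ "poly (pderiv Q) z" for z] poly_DERIV continuous_intros)
qed

locale monotone_branch =
  fixes Q :: "real poly" and a b \<alpha> \<beta> :: real and r S :: "real \<Rightarrow> real"
  assumes ab: "-1 \<le> a" "a < b" "b \<le> 1"
    and image: "poly Q ` {a..b} = {\<alpha>..\<beta>}" and \<alpha>\<beta>: "\<alpha> < \<beta>"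
    and deriv_sign: "(\<forall>x\<in>{a<..<b}. poly (pderiv Q) x > 0) \<or> (\<forall>x\<in>{a<..<b}. poly (pderiv Q) x < 0)"
  defines r_def: "r \<equiv> inv_into {a..b} (poly Q)" and S_def: "S \<equiv> extend_branch r \<alpha> \<beta>"
begin

lemma monotone_cases:
  obtains (mono) "strict_mono_on {a..b} (poly Q)" "\<forall>x\<in>{a<..<b}. poly (pderiv Q) x > 0"
  | (anti) "strict_antimono_on {a..b} (poly Q)" "\<forall>x\<in>{a<..<b}. poly (pderiv Q) x < 0"
proof -
  consider "\<forall>x\<in>{a<..<b}. poly (pderiv Q) x > 0" | "\<forall>x\<in>{a<..<b}. poly (pderiv Q) x < 0"
    using deriv_sign by blast
  then show thesis
  proof cases
    case 2
    then have "strict_mono_on {a..b} (poly (- Q))"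
      by (intro strict_mono_on_polyI) (simp add: pderiv_minus)
    then have "strict_antimono_on {a..b} (poly Q)"
      by (simp add: monotone_on_def)
    with 2 anti show thesis by blast
  qed (use strict_mono_on_polyI mono in blast)
qed

lemma inj: "inj_on (poly Q) {a..b}"
proof (cases rule: monotone_cases)
  case mono
  then show ?thesis by (intro strict_mono_on_imp_inj_on)
next
  case anti
  have "poly Q x \<noteq> poly Q y" if "x < y" "x \<in> {a..b}" "y \<in> {a..b}" for x y
    using monotone_onD[OF anti(1), of x y] that by simp
  then show ?thesis by (intro linorder_inj_onI) auto
qed

lemma r_in: "y \<in> {\<alpha>..\<beta>} \<Longrightarrow> r y \<in> {a..b}"
  unfolding r_def by (rule inv_into_into) (simp add: image)

lemma Q_r: "y \<in> {\<alpha>..\<beta>} \<Longrightarrow> poly Q (r y) = y"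
  unfolding r_def by (rule f_inv_into_f) (simp add: image)

lemma Q_in: "v \<in> {a..b} \<Longrightarrow> poly Q v \<in> {\<alpha>..\<beta>}"
  using image by blast

lemma continuous_on_r: "continuous_on {\<alpha>..\<beta>} r"
  unfolding image[symmetric]
  by (rule continuous_on_inv) (auto intro!: continuous_intros simp: r_def inj)

text \<open>If, say, \<open>Q\<close> increases and \<open>a < r \<alpha>\<close>, then
  \<open>Q\<close> at \<open>a\<close> would fall below \<alpha>, the minimum of the image.
  Consequently points strictly between \<alpha> and \<beta> have preimages inside (a, b), where the
  derivative of \<open>Q\<close> does not vanish.\<close>

lemma r_endpoints: "r \<alpha> \<in> {a, b}" "r \<beta> \<in> {a, b}" "r \<alpha> \<noteq> r \<beta>"
proof -
  have in_ab: "r \<alpha> \<in> {a..b}" "r \<beta> \<in> {a..b}" using r_in \<alpha>\<beta> by simp_all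
  have Q: "poly Q (r \<alpha>) = \<alpha>" "poly Q (r \<beta>) = \<beta>" using Q_r \<alpha>\<beta> by simp_all
  have Q_ab: "poly Q a \<in> {\<alpha>..\<beta>}" "poly Q b \<in> {\<alpha>..\<beta>}" using Q_in ab by simp_all
  show "r \<alpha> \<noteq> r \<beta>" using Q \<alpha>\<beta> by auto
  have "(r \<alpha> = a \<and> r \<beta> = b) \<or> (r \<alpha> = b \<and> r \<beta> = a)"
  proof (cases rule: monotone_cases)
    case mono
    have "\<not> a < r \<alpha>" "\<not> r \<beta> < b"
      using monotone_onD[OF mono(1), of a "r \<alpha>"] monotone_onD[OF mono(1), of "r \<beta>" b] in_ab Q Q_ab ab
      by auto
    with in_ab show ?thesis by auto
  next
    case anti
    have "\<not> a < r \<beta>" "\<not> r \<alpha> < b"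
      using monotone_onD[OF anti(1), of a "r \<beta>"] monotone_onD[OF anti(1), of "r \<alpha>" b] in_ab Q Q_ab ab
      by auto
    with in_ab show ?thesis by auto
  qed
  then show "r \<alpha> \<in> {a, b}" "r \<beta> \<in> {a, b}" by auto
qed

text \<open>The extension of the branch before the sign change that \<^const>\<open>extend_branch\<close> applies to increasing branches;
  that sign turns \<open>arccos\<close> into \<open>\<pi> - arccos\<close>, so that \<open>arccos \<circ> S\<close> is always nondecreasing.\<close>

definition clamped :: "real \<Rightarrow> real" where
  "clamped y = r (max \<alpha> (min \<beta> y))"

lemma clamped_in: "clamped y \<in> {a..b}"
  unfolding clamped_def by (rule r_in) (use \<alpha>\<beta> in auto)

lemma not_anti_if_mono: "strict_mono_on {a..b} (poly Q) \<Longrightarrow> \<not> strict_antimono_on {a..b} (poly Q)"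
  using ab monotone_onD[of "{a..b}" "(<)" "(<)" "poly Q" a b]
    monotone_onD[of "{a..b}" "(<)" "\<lambda>x y. y < x" "poly Q" a b] by auto

text \<open>\<open>extend_branch\<close> tests the orientation of the inverse, which is that of
  \<open>Q\<close> on [a, b]; clamping the argument merges the three cases of its
  definition.\<close>

lemma S_eq:
  "S y = (if strict_antimono_on {a..b} (poly Q) then clamped y else - clamped y)"
proof -
  have "strict_antimono_on {\<alpha>..\<beta>} r \<longleftrightarrow> strict_antimono_on {a..b} (poly Q)"
  proof (cases rule: monotone_cases)
    case mono
    have "\<not> r \<beta> < r \<alpha>"
      using monotone_onD[OF mono(1), of "r \<beta>" "r \<alpha>"] r_in Q_r \<alpha>\<beta> by auto
    then have "\<not> strict_antimono_on {\<alpha>..\<beta>} r"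
      using \<alpha>\<beta> monotone_onD[of "{\<alpha>..\<beta>}" "(<)" "\<lambda>x y. y < x" r \<alpha> \<beta>] by auto
    with not_anti_if_mono[OF mono(1)] show ?thesis by simp
  next
    case anti
    have "r y < r x" if xy: "x \<in> {\<alpha>..\<beta>}" "y \<in> {\<alpha>..\<beta>}" "x < y" for x y
    proof -
      have "\<not> r x < r y"
        using monotone_onD[OF anti(1), of "r x" "r y"] r_in Q_r xy by auto
      moreover have "r x \<noteq> r y" using Q_r[of x] Q_r[of y] xy by auto
      ultimately show ?thesis by simp
    qed
    then have "strict_antimono_on {\<alpha>..\<beta>} r" by (rule monotone_onI)
    with anti show ?thesis by simp
  qed
  moreover have "(if y < \<alpha> then r \<alpha> else if y > \<beta> then r \<beta> else r y) = clamped y"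
    using \<alpha>\<beta> by (auto simp: clamped_def max_def min_def)
  ultimately show ?thesis by (simp add: S_def extend_branch_def Let_def)
qed

lemma S_bounds: "-1 \<le> S y" "S y \<le> 1"
  using clamped_in[of y] ab by (auto simp: S_eq)

lemma continuous_on_S: "continuous_on A S"
proof -
  have "continuous_on A clamped"
    unfolding clamped_def
    by (rule continuous_on_compose2[OF continuous_on_r]) (use \<alpha>\<beta> in \<open>auto intro!: continuous_intros\<close>)
  then show ?thesis
    unfolding S_eq[abs_def]
    by (cases "strict_antimono_on {a..b} (poly Q)") (simp_all add: continuous_on_minus)
qed

lemma continuous_on_arccos_S: "continuous_on A (\<lambda>y. arccos (S y))"
  by (rule continuous_on_compose2[OF continuous_on_arccos' continuous_on_S]) (use S_bounds in auto)

lemma S_const_below: "y \<le> \<alpha> \<Longrightarrow> S y = S \<alpha>"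
  and S_const_above: "y \<ge> \<beta> \<Longrightarrow> S y = S \<beta>"
  using \<alpha>\<beta> by (auto simp: S_eq clamped_def max_def min_def)

text \<open>On a decreasing branch the sublevel set of \<open>Q\<close> lies to the right of
  \<open>clamped y\<close>. The point \<open>clamped y\<close> itself belongs to it only when
  \<open>y\<close> exceeds \<beta>, hence one strict and one weak inequality; a single value has
  density zero.\<close>

lemma less_iff_anti:
  assumes anti: "strict_antimono_on {a..b} (poly Q)" and v: "v \<in> {a..b}"
  shows "clamped y < v \<Longrightarrow> poly Q v < y" and "poly Q v < y \<Longrightarrow> clamped y \<le> v"
proof -
  let ?y = "max \<alpha> (min \<beta> y)"
  have y: "poly Q (clamped y) = ?y" unfolding clamped_def by (rule Q_r) (use \<alpha>\<beta> in auto)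
  note Qv = Q_in[OF v]
  {
    assume "clamped y < v"
    then have "poly Q v < ?y" using monotone_onD[OF anti, of "clamped y" "v"] v clamped_in[of y] y by auto
    with Qv show "poly Q v < y" by auto
  }
  {
    assume *: "poly Q v < y"
    show "clamped y \<le> v"
    proof (rule ccontr)
      assume "\<not> clamped y \<le> v"
      then have "?y < poly Q v" using monotone_onD[OF anti, of "v" "clamped y"] v clamped_in[of y] y by auto
      with Qv * show False by auto
    qed
  }
qed

text \<open>The mirror image: on an increasing branch the sublevel set lies to the left of
  \<open>clamped y\<close>.\<close>

lemma less_iff_mono:
  assumes mono: "strict_mono_on {a..b} (poly Q)" and v: "v \<in> {a..b}"
  shows "v < clamped y \<Longrightarrow> poly Q v < y" and "poly Q v < y \<Longrightarrow> v \<le> clamped y"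
proof -
  let ?y = "max \<alpha> (min \<beta> y)"
  have y: "poly Q (clamped y) = ?y" unfolding clamped_def by (rule Q_r) (use \<alpha>\<beta> in auto)
  note Qv = Q_in[OF v]
  {
    assume "v < clamped y"
    then have "poly Q v < ?y" using monotone_onD[OF mono, of "v" "clamped y"] v clamped_in[of y] y by auto
    with Qv show "poly Q v < y" by auto
  }
  {
    assume *: "poly Q v < y"
    show "v \<le> clamped y"
    proof (rule ccontr)
      assume "\<not> v \<le> clamped y"
      then have "?y < poly Q v" using monotone_onD[OF mono, of "clamped y" "v"] v clamped_in[of y] y by auto
      with Qv * show False by auto
    qed
  }
qed

text \<open>\<open>C\<close> is \<open>arccos b / \<pi>\<close> on a decreasing branch and \<open>1 - arccos a / \<pi>\<close> on an increasing one;
  it cancels in the differences \<open>g (x + i) - g i\<close>.\<close>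

lemma mean_branch_below:
  assumes "equidistributed_angle \<phi>"
  shows "\<exists>C. \<forall>y. has_mean (\<lambda>n. of_bool (a \<le> cos (real n * \<phi>) \<and> cos (real n * \<phi>) < b \<and>
    poly Q (cos (real n * \<phi>)) < y)) (arccos (S y) / pi - C)"
proof -
  interpret equidistributed_angle \<phi> by fact
  have lt: "has_mean (\<lambda>n. of_bool (cos (real n * \<phi>) < z)) (1 - arccos z / pi)"
    and le: "has_mean (\<lambda>n. of_bool (cos (real n * \<phi>) \<le> z)) (1 - arccos z / pi)"
    if "-1 \<le> z" "z \<le> 1" for z
    by (rule mean_cos_below; use that in simp)+
  let ?h = "\<lambda>y n. of_bool (a \<le> cos (real n * \<phi>) \<and> cos (real n * \<phi>) < b \<and>
    poly Q (cos (real n * \<phi>)) < y) :: real"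
  note cl = clamped_in[unfolded atLeastAtMost_iff]
  show ?thesis
  proof (cases rule: monotone_cases)
    case anti
    \<comment> \<open>The sublevel set in [a, b) is squeezed between (\<open>clamped y\<close>, b)
      and [\<open>clamped y\<close>, b), of equal density. If \<open>clamped y = b\<close>, the
      lower bound is -1 at the value \<open>b\<close>, which is harmless.\<close>
    have "has_mean (?h y) (arccos (S y) / pi - arccos b / pi)" for y
    proof (rule has_mean_between)
      show "has_mean (\<lambda>n. of_bool (cos (real n * \<phi>) < b) - of_bool (cos (real n * \<phi>) \<le> S y))
        (arccos (S y) / pi - arccos b / pi)"
        using has_mean_diff[OF lt[of b] le[of "S y"]] ab S_bounds[of y] by simp
      show "has_mean (\<lambda>n. of_bool (cos (real n * \<phi>) < b) - of_bool (cos (real n * \<phi>) < S y))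
        (arccos (S y) / pi - arccos b / pi)"
        using has_mean_diff[OF lt[of b] lt[of "S y"]] ab S_bounds[of y] by simp
      fix n
      have S: "S y = clamped y" using anti by (simp add: S_eq)
      show "of_bool (cos (real n * \<phi>) < b) - of_bool (cos (real n * \<phi>) \<le> S y) \<le> ?h y n"
        using less_iff_anti(1)[OF anti(1), of "cos (real n * \<phi>)" y] cl[of y]
        by (cases "clamped y < cos (real n * \<phi>)") (auto simp: S)
      show "?h y n \<le> of_bool (cos (real n * \<phi>) < b) - of_bool (cos (real n * \<phi>) < S y)"
        using less_iff_anti(2)[OF anti(1), of "cos (real n * \<phi>)" y] cl[of y] by (auto simp: S)
    qed
    then show ?thesis by blast
  next
    case mono
    have S: "S y = - clamped y" for y using not_anti_if_mono[OF mono(1)] by (simp add: S_eq)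
    \<comment> \<open>Here the bounds come from [a, \<open>clamped y\<close>) and
      [a, \<open>clamped y\<close>]; \<open>1 - arccos a / pi\<close> is the density of cosines
      below \<open>a\<close>.\<close>
    have "has_mean (?h y) (arccos (S y) / pi - (1 - arccos a / pi))" for y
    proof (rule has_mean_between)
      have bounds: "-1 \<le> clamped y" "clamped y \<le> 1" using cl[of y] ab by auto
      then have S': "arccos (S y) = pi - arccos (clamped y)"
        unfolding S by (simp add: arccos_minus)
      show "has_mean (\<lambda>n. of_bool (cos (real n * \<phi>) < clamped y) - of_bool (cos (real n * \<phi>) < a))
        (arccos (S y) / pi - (1 - arccos a / pi))"
        using has_mean_diff[OF lt[OF bounds] lt[of a]] ab
        unfolding S' by (simp add: diff_divide_distrib)
      show "has_mean (\<lambda>n. of_bool (cos (real n * \<phi>) \<le> clamped y) - of_bool (cos (real n * \<phi>) < a))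
        (arccos (S y) / pi - (1 - arccos a / pi))"
        using has_mean_diff[OF le[OF bounds] lt[of a]] ab
        unfolding S' by (simp add: diff_divide_distrib)
      fix n
      show "of_bool (cos (real n * \<phi>) < clamped y) - of_bool (cos (real n * \<phi>) < a) \<le> ?h y n"
        using less_iff_mono(1)[OF mono(1), of "cos (real n * \<phi>)" y] cl[of y]
        by (cases "cos (real n * \<phi>) < a") auto
      show "?h y n \<le> of_bool (cos (real n * \<phi>) \<le> clamped y) - of_bool (cos (real n * \<phi>) < a)"
        using less_iff_mono(2)[OF mono(1), of "cos (real n * \<phi>)" y] cl[of y] by auto
    qed
    then show ?thesis by blast
  qed
qed

text \<open>Outside [\<alpha>, \<beta>] the extension is locally constant. Inside, the inverse
  function rule and the chain rule apply, and the sign built into \<open>S\<close> makes the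
  derivative nonnegative, which is where the absolute value comes from.\<close>

lemma arccos_S_derivative:
  assumes y: "y \<noteq> \<alpha>" "y \<noteq> \<beta>"
  shows "((\<lambda>y. arccos (S y)) has_real_derivative
    (if y \<in> {\<alpha>..\<beta>} then \<bar>deriv (\<lambda>y. arccos (r y)) y\<bar> else 0)) (at y)"
proof -
  consider "y < \<alpha>" | "y > \<beta>" | "y \<in> {\<alpha><..<\<beta>}" using y by force
  then show ?thesis
  proof cases
    case 1
    have "((\<lambda>y. arccos (S y)) has_real_derivative 0) (at y)"
    proof (rule has_field_derivative_transform_within_open[OF DERIV_const])
      show "open {..<\<alpha>}" "y \<in> {..<\<alpha>}" using 1 by auto
      fix z assume "z \<in> {..<\<alpha>}"
      then show "arccos (S \<alpha>) = arccos (S z)" using S_const_below[of z] by simp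
    qed
    with 1 show ?thesis by auto
  next
    case 2
    have "((\<lambda>y. arccos (S y)) has_real_derivative 0) (at y)"
    proof (rule has_field_derivative_transform_within_open[OF DERIV_const])
      show "open {\<beta><..}" "y \<in> {\<beta><..}" using 2 by auto
      fix z assume "z \<in> {\<beta><..}"
      then show "arccos (S \<beta>) = arccos (S z)" using S_const_above[of z] by simp
    qed
    with 2 show ?thesis by auto
  next
    case 3
    then have "r y \<noteq> r \<alpha>" "r y \<noteq> r \<beta>" 
      using Q_r[of y] Q_r[of \<alpha>] Q_r[of \<beta>] \<alpha>\<beta> by auto
    \<comment> \<open>An interior preimage ensures that the derivative \<open>D\<close> of
      \<open>Q\<close> is nonzero and that |\<open>r y\<close>| < 1, so both factors of
      \<open>E\<close> are finite; \<open>E\<close> has the sign opposite to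
      \<open>D\<close>.\<close>
    then have ry: "r y \<in> {a<..<b}" using r_endpoints r_in[of y] 3 by auto
    define D where "D = poly (pderiv Q) (r y)"
    define E where "E = inverse (- sqrt (1 - (r y)\<^sup>2)) * inverse D"
    have "D \<noteq> 0" unfolding D_def using deriv_sign ry by force
    have "isCont r y"
      using continuous_on_interior[OF continuous_on_r] 3 by simp
    then have "(r has_real_derivative inverse D) (at y)"
      using 3 \<open>D \<noteq> 0\<close> Q_r unfolding D_def
      by (intro DERIV_inverse_function[where f = "poly Q" and a = \<alpha> and b = \<beta>] poly_DERIV) auto
    then have E: "((\<lambda>y. arccos (r y)) has_real_derivative E) (at y)"
      unfolding E_def using ry ab by (intro DERIV_chain2[OF DERIV_arccos]) auto
    then have deriv: "deriv (\<lambda>y. arccos (r y)) y = E" by (rule DERIV_imp_deriv)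
    have root: "sqrt (1 - (r y)\<^sup>2) > 0"
    proof -
      have "\<bar>r y\<bar> < 1" using ry ab by (auto simp: abs_less_iff)
      then show ?thesis by (simp add: abs_square_less_1)
    qed
    have cl: "clamped z = r z" if "z \<in> {\<alpha><..<\<beta>}" for z
      using that by (simp add: clamped_def max_def min_def)
    show ?thesis
    proof (cases rule: monotone_cases)
      case anti
      then have "D < 0" using ry by (simp add: D_def)
      then have "E \<ge> 0" unfolding E_def using root by (intro mult_nonpos_nonpos) auto
      then have "\<bar>E\<bar> = E" by simp
      moreover have "((\<lambda>y. arccos (S y)) has_real_derivative E) (at y)"
      proof (rule has_field_derivative_transform_within_open[OF E])
        show "open {\<alpha><..<\<beta>}" "y \<in> {\<alpha><..<\<beta>}" using 3 by auto
        fix z assume "z \<in> {\<alpha><..<\<beta>}"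
        then show "arccos (r z) = arccos (S z)" using anti cl by (simp add: S_eq)
      qed
      ultimately show ?thesis using 3 by (simp add: deriv)
    next
      case mono
      then have "D > 0" using ry by (simp add: D_def)
      then have "E \<le> 0" unfolding E_def using root by (intro mult_nonpos_nonneg) auto
      then have "\<bar>E\<bar> = - E" by simp
      moreover have "((\<lambda>y. arccos (S y)) has_real_derivative - E) (at y)"
      proof (rule has_field_derivative_transform_within_open)
        show "((\<lambda>y. pi - arccos (r y)) has_real_derivative - E) (at y)"
          using DERIV_diff[OF DERIV_const E, of pi] by simp
        show "open {\<alpha><..<\<beta>}" "y \<in> {\<alpha><..<\<beta>}" using 3 by auto
        fix z assume "z \<in> {\<alpha><..<\<beta>}"
        then show "pi - arccos (r z) = arccos (S z)"
          using not_anti_if_mono[OF mono(1)] cl r_in[of z] ab by (simp add: S_eq arccos_minus)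
      qed
      ultimately show ?thesis using 3 by (simp add: deriv)
    qed
  qed
qed

lemma arccos_S_derivative_shift:
  assumes "x + z \<noteq> \<alpha>" "x + z \<noteq> \<beta>"
  shows "((\<lambda>x. arccos (S (x + z))) has_real_derivative
    (if x + z \<in> {\<alpha>..\<beta>} then \<bar>deriv (\<lambda>x. arccos (r (x + z))) x\<bar> else 0)) (at x)"
proof -
  \<comment> \<open>\<open>deriv\<close> chooses a value of the \<open>DERIV\<close> relation, which
    is invariant under the shift, so both choices agree.\<close>
  have eq: "deriv (\<lambda>x. arccos (r (x + z))) x = deriv (\<lambda>y. arccos (r y)) (x + z)"
    unfolding deriv_def DERIV_shift ..
  show ?thesis
    using arccos_S_derivative[OF assms] unfolding eq DERIV_shift .
qed

end

section \<open>The repartition function\<close>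

text \<open>Once |\<epsilon> n| < \<delta>, the event lies between \<open>v n < y - \<delta>\<close>
  and \<open>v n < y + \<delta>\<close>, whose densities are close to \<open>G y\<close> by
  continuity.\<close>

lemma has_mean_perturbed:
  fixes v \<epsilon> :: "nat \<Rightarrow> real" and G :: "real \<Rightarrow> real" and y :: real
  assumes mean: "\<And>y. has_mean (\<lambda>n. of_bool (v n < y)) (G y)"
    and cont: "continuous_on UNIV G" and eps: "\<epsilon> \<longlonglongrightarrow> 0"
  shows "has_mean (\<lambda>n. of_bool (v n + \<epsilon> n < y)) (G y)"
proof -
  have near: "\<exists>\<delta>>0. \<bar>G (y + \<delta>) - G y\<bar> < e \<and> \<bar>G (y - \<delta>) - G y\<bar> < e" if e: "e > 0" for e
  proof -
    obtain \<delta> where \<delta>: "\<delta> > 0" "\<And>x. \<bar>x - y\<bar> < \<delta> \<Longrightarrow> \<bar>G x - G y\<bar> < e"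
      using cont[unfolded continuous_on_iff, rule_format, of y e] e by (auto simp: dist_real_def)
    then show ?thesis by (intro exI[of _ "\<delta> / 2"]) auto
  qed
  show ?thesis
  proof (rule has_mean_squeeze)
    fix e :: real assume "e > 0"
    then obtain \<delta> where \<delta>: "\<delta> > 0" "\<bar>G (y + \<delta>) - G y\<bar> < e" "\<bar>G (y - \<delta>) - G y\<bar> < e"
      using near by blast
    have ev: "\<forall>\<^sub>F n in sequentially. \<bar>\<epsilon> n\<bar> < \<delta>"
      using tendstoD[OF eps \<delta>(1)] by (simp add: dist_real_def)
    have "\<forall>\<^sub>F n in sequentially. of_bool (v n < y - \<delta>) \<le> (of_bool (v n + \<epsilon> n < y) :: real)"
      using ev by eventually_elim auto
    with mean[of "y - \<delta>"] \<delta>(3)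
    show "\<exists>f a. has_mean f a \<and> (\<forall>\<^sub>F n in sequentially. f n \<le> of_bool (v n + \<epsilon> n < y)) \<and> G y - e \<le> a"
      by (intro exI[of _ "\<lambda>n. of_bool (v n < y - \<delta>)"] exI[of _ "G (y - \<delta>)"]) auto
    have "\<forall>\<^sub>F n in sequentially. (of_bool (v n + \<epsilon> n < y) :: real) \<le> of_bool (v n < y + \<delta>)"
      using ev by eventually_elim auto
    with mean[of "y + \<delta>"] \<delta>(2)
    show "\<exists>f a. has_mean f a \<and> (\<forall>\<^sub>F n in sequentially. of_bool (v n + \<epsilon> n < y) \<le> f n) \<and> a \<le> G y + e"
      by (intro exI[of _ "\<lambda>n. of_bool (v n < y + \<delta>)"] exI[of _ "G (y + \<delta>)"]) auto
  qed
qed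

text \<open>For x in [0, 1] the summand indicates \<open>i \<le> w < i + x\<close>, so only
  \<open>i = \<lfloor>w\<rfloor>\<close> can contribute. That this index lies in [-M, M] means that
  \<open>w\<close> lies in [-M, M + 1).\<close>

lemma sum_indicator_shifts:
  fixes w x :: real
  assumes "0 \<le> x" "x \<le> 1"
  shows "(\<Sum>i=-int M..int M. of_bool (w < x + of_int i) - of_bool (w < of_int i)) =
    (of_bool (frac w < x \<and> - real M \<le> w \<and> w < real M + 1) :: real)"
proof -
  have "(of_bool (w < x + of_int i) - of_bool (w < of_int i) :: real) =
      (if i = \<lfloor>w\<rfloor> then of_bool (frac w < x) else 0)" for i
  proof -
    have "i = \<lfloor>w\<rfloor> \<longleftrightarrow> of_int i \<le> w \<and> w < of_int i + 1" by linarith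
    then show ?thesis using assms by (auto simp: frac_def)
  qed
  then have "(\<Sum>i=-int M..int M. of_bool (w < x + of_int i) - of_bool (w < of_int i)) =
      (if \<lfloor>w\<rfloor> \<in> {-int M..int M} then of_bool (frac w < x) else (0::real))"
    by (simp add: sum.delta')
  moreover have "\<lfloor>w\<rfloor> \<in> {-int M..int M} \<longleftrightarrow> - real M \<le> w \<and> w < real M + 1"
  proof -
    have "- int M \<le> \<lfloor>w\<rfloor> \<longleftrightarrow> - real M \<le> w" by (simp add: le_floor_iff)
    moreover have "\<lfloor>w\<rfloor> \<le> int M \<longleftrightarrow> w < real M + 1" by (simp add: floor_le_iff)
    ultimately show ?thesis by simp
  qed
  ultimately show ?thesis by auto
qed

text \<open>\<open>M\<close> bounds the limit law only, so \<open>w\<close> may leave \<open>[-M, M + 1)\<close>, but with density zero.\<close>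

lemma mean_frac_less:
  fixes w :: "nat \<Rightarrow> real"
  assumes mean: "\<And>y. has_mean (\<lambda>n. of_bool (w n < y)) (G y)"
    and "G (- real M) = 0" "G (real M + 1) = 1"
    and x: "0 \<le> x" "x \<le> 1"
  shows "has_mean (\<lambda>n. of_bool (frac (w n) < x)) (\<Sum>i=-int M..int M. G (x + of_int i) - G (of_int i))"
    (is "has_mean _ ?s")
proof (rule has_mean_between)
  let ?F = "\<lambda>n. \<Sum>i=-int M..int M. of_bool (w n < x + of_int i) - of_bool (w n < of_int i) :: real"
  \<comment> \<open>The indicator of leaving [-M, M + 1); the values of \<open>G\<close> at the two
    ends give it mean 0.\<close>
  let ?E = "\<lambda>n. of_bool (w n < - real M) + (1 - of_bool (w n < real M + 1)) :: real"
  show F: "has_mean ?F ?s" by (intro has_mean_sum has_mean_diff mean)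
  have "has_mean ?E (G (- real M) + (1 - G (real M + 1)))"
    by (intro has_mean_add has_mean_diff has_mean_const mean)
  with has_mean_add[OF F] assms show "has_mean (\<lambda>n. ?F n + ?E n) ?s" by fastforce
  fix n
  show "?F n \<le> of_bool (frac (w n) < x)" "of_bool (frac (w n) < x) \<le> ?F n + ?E n"
    unfolding sum_indicator_shifts[OF x] by auto
qed

lemma has_repartition_function_iff_mean:
  "has_repartition_function u f \<longleftrightarrow> (\<forall>x\<in>{0..1}. has_mean (\<lambda>n. of_bool (frac (u n) < x)) (f x))"
proof -
  have "(\<Sum>n<N. of_bool (P n)) = real (card {n. n < N \<and> P n})" for N :: nat and P
    by (simp add: sum_of_bool_eq Int_def)
  then show ?thesis by (simp add: has_repartition_function_def has_mean_def)
qed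

section \<open>Joining the branches and reducing the sequence modulo 1\<close>

locale salem_sequence =
  fixes \<theta> \<phi> :: real and P :: "int poly" and K M :: nat and c \<alpha> \<beta> :: "nat \<Rightarrow> real"
  assumes \<theta>: "\<theta> > 1"
    and trace: "\<And>n. \<theta> ^ n + inverse \<theta> ^ n + 2 * cos (real n * \<phi>) \<in> \<int>"
    and angle: "equidistributed_angle \<phi>"
    and partition: "critical_partition (Q_poly P) K c"
    and images: "\<forall>k\<in>{1..K}. poly (Q_poly P) ` {c (k-1)..c k} = {\<alpha> k..\<beta> k} \<and> \<alpha> k < \<beta> k"
    and M: "real M \<ge> Max ((\<lambda>k. \<bar>\<alpha> k\<bar>) ` {1..K} \<union> (\<lambda>k. \<bar>\<beta> k\<bar>) ` {1..K})"
begin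

abbreviation "Q \<equiv> Q_poly P"
abbreviation "r k \<equiv> inverse_branch Q c k"
abbreviation "S k \<equiv> extend_branch (r k) (\<alpha> k) (\<beta> k)"
abbreviation "g \<equiv> g_fun Q K c \<alpha> \<beta>"

lemma c_mono: "i < j \<Longrightarrow> j \<le> K \<Longrightarrow> c i < c j"
  using partition unfolding critical_partition_def by (auto simp: monotone_on_def)

lemma branch:
  assumes "k \<in> {1..K}"
  shows "monotone_branch Q (c (k - 1)) (c k) (\<alpha> k) (\<beta> k)"
proof
  have c: "c 0 = -1" "c K = 1" using partition by (auto simp: critical_partition_def)
  show "-1 \<le> c (k - 1)" using c_mono[of 0 "k - 1"] c assms by (cases "k = 1") force+
  show "c k \<le> 1" using c_mono[of k K] c assms by (cases "k = K") auto
  show "c (k - 1) < c k" using assms by (intro c_mono) auto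
qed (use images partition assms in \<open>auto simp: critical_partition_def\<close>)

text \<open>The half-open intervals [c (k-1), c k) cover [-1, 1) and miss the value 1, which thus
  has density zero.\<close>

lemma mean_cos_less_1: "has_mean (\<lambda>n. of_bool (cos (real n * \<phi>) < 1)) 1"
  using equidistributed_angle.mean_cos_below[OF angle, of 1 "\<lambda>n. of_bool (cos (real n * \<phi>) < 1)"]
  by simp

text \<open>The branch intervals are disjoint, so their densities add, and \<open>C\<close> is the
  sum of the branch constants.\<close>

lemma mean_Q_cos_below:
  "\<exists>C. \<forall>y. has_mean (\<lambda>n. of_bool (poly Q (cos (real n * \<phi>)) < y)) (g y - C)"
proof -
  have "\<forall>k\<in>{1..K}. \<exists>C. \<forall>y. has_mean (\<lambda>n. of_bool (c (k - 1) \<le> cos (real n * \<phi>) \<and> cos (real n * \<phi>) < c k \<and>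
    poly Q (cos (real n * \<phi>)) < y)) (arccos (S k y) / pi - C)"
    using monotone_branch.mean_branch_below[OF branch angle] by (simp add: inverse_branch_def)
  from bchoice[OF this] obtain C where C: "\<And>k y. k \<in> {1..K} \<Longrightarrow>
    has_mean (\<lambda>n. of_bool (c (k - 1) \<le> cos (real n * \<phi>) \<and> cos (real n * \<phi>) < c k \<and>
      poly Q (cos (real n * \<phi>)) < y)) (arccos (S k y) / pi - C k)"
    by blast
  have "has_mean (\<lambda>n. of_bool (poly Q (cos (real n * \<phi>)) < y)) (g y - (\<Sum>k=1..K. C k))" for y
  proof -
    \<comment> \<open>The intervals are joined one by one, starting from \<open>c 0 = -1\<close>,
      below which no cosine lies.\<close>
    have "has_mean (\<lambda>n. of_bool (cos (real n * \<phi>) < c k \<and> poly Q (cos (real n * \<phi>)) < y))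
        (\<Sum>k=1..k. arccos (S k y) / pi - C k)" if "k \<le> K" for k
      using that
    proof (induction k)
      case 0
      have "c 0 = -1" using partition by (auto simp: critical_partition_def)
      then have "\<not> cos t < c 0" for t by (simp add: not_less)
      then show ?case using has_mean_const[of 0] by simp
    next
      case (Suc k)
      have "c k < c (Suc k)" using c_mono Suc by simp
      then have "(of_bool (cos t < c (Suc k) \<and> poly Q (cos t) < y) :: real) =
          of_bool (cos t < c k \<and> poly Q (cos t) < y) +
          of_bool (c (Suc k - 1) \<le> cos t \<and> cos t < c (Suc k) \<and> poly Q (cos t) < y)" for t
        by auto
      then show ?case
        using has_mean_add[OF Suc.IH C[of "Suc k" y]] Suc.prems by simp
    qed
    from this[of K] have *: "has_mean (\<lambda>n. of_bool (cos (real n * \<phi>) < 1 \<and> poly Q (cos (real n * \<phi>)) < y))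
        (g y - (\<Sum>k=1..K. C k))"
      using partition
      by (simp add: critical_partition_def g_fun_def sum_subtractf sum_divide_distrib)
    show ?thesis
    proof (rule has_mean_between[OF *])
      show "has_mean (\<lambda>n. of_bool (cos (real n * \<phi>) < 1 \<and> poly Q (cos (real n * \<phi>)) < y) +
          (1 - of_bool (cos (real n * \<phi>) < 1))) (g y - (\<Sum>k=1..K. C k))"
        using has_mean_add[OF * has_mean_diff[OF has_mean_const[of 1] mean_cos_less_1]] by simp
    qed auto
  qed
  then show ?thesis by blast
qed

lemma continuous_g: "continuous_on A g"
proof -
  have "continuous_on A (\<lambda>y. arccos (S k y))" if "k \<in> {1..K}" for k
    using monotone_branch.continuous_on_arccos_S[OF branch[OF that]] by (simp add: inverse_branch_def)
  then show ?thesis unfolding g_fun_def[abs_def]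
    by (intro continuous_on_mult continuous_on_const continuous_on_sum) blast
qed

lemma abs_le_M: "k \<in> {1..K} \<Longrightarrow> \<bar>\<alpha> k\<bar> \<le> real M" "k \<in> {1..K} \<Longrightarrow> \<bar>\<beta> k\<bar> \<le> real M"
  by (rule order.trans[OF Max_ge M]; simp)+

text \<open>Beyond -M and M all extended branches are constant, so \<open>g\<close> there equals its
  value at far-away arguments, where the density of the sublevel set is plainly 0 or 1.\<close>

lemma g_const: "y \<le> - real M \<Longrightarrow> g y = g (- real M)" "y \<ge> real M \<Longrightarrow> g y = g (real M)"
proof -
  have "S k y = S k (- real M)" if "k \<in> {1..K}" "y \<le> - real M" for k
  proof -
    have "y \<le> \<alpha> k" "- real M \<le> \<alpha> k" using abs_le_M[OF that(1)] that(2) by auto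
    then show ?thesis
      using monotone_branch.S_const_below[OF branch[OF that(1)]] by (metis inverse_branch_def)
  qed
  then show "y \<le> - real M \<Longrightarrow> g y = g (- real M)" unfolding g_fun_def by simp
  have "S k y = S k (real M)" if "k \<in> {1..K}" "y \<ge> real M" for k
  proof -
    have "y \<ge> \<beta> k" "real M \<ge> \<beta> k" using abs_le_M[OF that(1)] that(2) by auto
    then show ?thesis
      using monotone_branch.S_const_above[OF branch[OF that(1)]] by (metis inverse_branch_def)
  qed
  then show "y \<ge> real M \<Longrightarrow> g y = g (real M)" unfolding g_fun_def by simp
qed

text \<open>Up to integers, \<open>u n\<close> is \<open>Q (cos (n \<phi>))\<close> plus the contribution of the conjugate \<open>1 / \<theta>\<close>.\<close>

definition \<epsilon> :: "nat \<Rightarrow> real" where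
  "\<epsilon> n = - (\<Sum>j=1..degree P. of_int (coeff P j) * inverse \<theta> ^ (n * j))"

lemma eps_tendsto_0: "\<epsilon> \<longlonglongrightarrow> 0"
proof -
  have "(\<lambda>n. inverse \<theta> ^ (n * j)) \<longlonglongrightarrow> 0" if "j \<in> {1..degree P}" for j
  proof -
    \<comment> \<open>The sum in \<open>\<epsilon>\<close> starts at j = 1; the constant term j = 0
      would not decay.\<close>
    have "inverse \<theta> ^ j < 1" using \<theta> that by (simp add: power_less_one_iff inverse_less_1_iff)
    then have "(\<lambda>n. (inverse \<theta> ^ j) ^ n) \<longlonglongrightarrow> 0" using \<theta> by (intro LIMSEQ_realpow_zero) auto
    then show ?thesis by (simp add: mult.commute flip: power_mult)
  qed
  then have "(\<lambda>n. - (\<Sum>j=1..degree P. of_int (coeff P j) * inverse \<theta> ^ (n * j))) \<longlonglongrightarrow>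
      - (\<Sum>j=1..degree P. of_int (coeff P j) * 0)"
    by (intro tendsto_intros)
  then show ?thesis by (simp add: \<epsilon>_def[abs_def])
qed

text \<open>The arguments differ by an integral combination of the traces at exponents
  \<open>n * j\<close>, minus \<open>coeff P 0\<close> because \<open>\<epsilon>\<close> omits j =
  0. The factor -2 in \<open>Q_poly\<close> matches the term 2 cos of the trace.\<close>

lemma frac_u:
  "frac (poly (map_poly of_int P) (\<theta> ^ n)) = frac (poly Q (cos (real n * \<phi>)) + \<epsilon> n)"
proof -
  let ?a = "\<lambda>j. of_int (coeff P j) :: real"
  have u: "poly (map_poly of_int P) (\<theta> ^ n) = (\<Sum>j\<le>degree P. ?a j * \<theta> ^ (n * j))"
    by (simp add: poly_altdef degree_map_poly coeff_map_poly power_mult)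
  have Q: "poly Q (cos (real n * \<phi>)) = - (\<Sum>j\<le>degree P. ?a j * (2 * cos (real (n * j) * \<phi>)))"
    by (simp add: Q_poly_def poly_sum poly_Cheb_T_cos sum_distrib_left mult_ac sum_negf)
  have eps: "\<epsilon> n = ?a 0 - (\<Sum>j\<le>degree P. ?a j * inverse \<theta> ^ (n * j))"
    by (simp add: \<epsilon>_def atMost_atLeast0 sum.atLeast_Suc_atMost)
  have "poly (map_poly of_int P) (\<theta> ^ n) - (poly Q (cos (real n * \<phi>)) + \<epsilon> n) =
      (\<Sum>j\<le>degree P. ?a j * (\<theta> ^ (n * j) + inverse \<theta> ^ (n * j) + 2 * cos (real (n * j) * \<phi>))) - ?a 0"
    unfolding u Q eps by (simp only: distrib_left sum.distrib)
  also have "\<dots> \<in> \<int>"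
    by (intro Ints_diff Ints_sum Ints_mult Ints_of_int trace)
  finally obtain m where
    "poly (map_poly of_int P) (\<theta> ^ n) - (poly Q (cos (real n * \<phi>)) + \<epsilon> n) = of_int m"
    by (rule Ints_cases)
  then have "poly (map_poly of_int P) (\<theta> ^ n) = (poly Q (cos (real n * \<phi>)) + \<epsilon> n) + of_int m" by simp
  then show ?thesis by (simp add: frac_def)
qed

lemma repartition:
  "has_repartition_function (\<lambda>n. poly (map_poly of_int P) (\<theta> ^ n)) (f_fun Q K c \<alpha> \<beta> M)"
proof -
  obtain C where C: "\<And>y. has_mean (\<lambda>n. of_bool (poly Q (cos (real n * \<phi>)) < y)) (g y - C)"
    using mean_Q_cos_below by blast
  have "compact (poly Q ` {-1..1})"
    by (intro compact_continuous_image continuous_intros) simp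
  then obtain B where B: "\<And>t. \<bar>poly Q (cos t)\<bar> \<le> B"
    by (force dest!: compact_imp_bounded simp: bounded_real)
  have lo: "g (- real M) - C = 0"
  proof -
    \<comment> \<open>Low enough for \<open>g\<close> to be constant and for no value of
      \<open>Q\<close> on [-1, 1] to lie below; density 0 then determines \<open>C\<close>.\<close>
    define y where "y = min (- real M) (- B)"
    have "\<not> poly Q (cos t) < y" for t using B[of t] by (auto simp: y_def)
    with C[of y] have "has_mean (\<lambda>n. 0) (g y - C)" by simp
    then have "g y - C = 0" using has_mean_unique has_mean_const by blast
    then show ?thesis using g_const(1)[of y] by (simp add: y_def)
  qed
  have hi: "g (real M + 1) - C = 1"
  proof -
    \<comment> \<open>\<open>B + 1\<close> makes the inequality strict for all values of
      \<open>Q\<close>, so the density is 1; \<open>g\<close> is constant from M on, so M + 1 gives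
      the same value.\<close>
    define y where "y = max (real M) (B + 1)"
    have "poly Q (cos t) < y" for t using B[of t] by (auto simp: y_def)
    with C[of y] have "has_mean (\<lambda>n. 1) (g y - C)" by simp
    then have "g y - C = 1" using has_mean_unique has_mean_const by blast
    then show ?thesis using g_const(2)[of y] g_const(2)[of "real M + 1"] by (simp add: y_def)
  qed
  have w: "has_mean (\<lambda>n. of_bool (poly Q (cos (real n * \<phi>)) + \<epsilon> n < y)) (g y - C)" for y
    by (rule has_mean_perturbed[OF C _ eps_tendsto_0]) (intro continuous_intros continuous_g)
  show ?thesis
    unfolding has_repartition_function_iff_mean frac_u
  proof
    fix x :: real assume "x \<in> {0..1}"
    then show "has_mean (\<lambda>n. of_bool (frac (poly Q (cos (real n * \<phi>)) + \<epsilon> n) < x)) (f_fun Q K c \<alpha> \<beta> M x)"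
      using mean_frac_less[OF w lo hi, of x] by (simp add: f_fun_def)
  qed
qed

lemma derivative:
  assumes "\<forall>i\<in>{-int M..int M}. \<forall>k\<in>{1..K}. x + of_int i \<noteq> \<alpha> k \<and> x + of_int i \<noteq> \<beta> k"
  shows "(f_fun Q K c \<alpha> \<beta> M has_real_derivative f_deriv Q K c \<alpha> \<beta> M x) (at x within A)"
proof -
  have S: "((\<lambda>x. arccos (S k (x + of_int i))) has_real_derivative
      (if x + of_int i \<in> {\<alpha> k..\<beta> k} then \<bar>deriv (\<lambda>y. arccos (r k (y + of_int i))) x\<bar> else 0)) (at x within A)"
    if "i \<in> {-int M..int M}" "k \<in> {1..K}" for i k
    using monotone_branch.arccos_S_derivative_shift[OF branch[OF that(2)], of x "of_int i"] assms that
    unfolding inverse_branch_def[symmetric] by (blast intro: has_field_derivative_at_within)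
  have "((\<lambda>x. \<Sum>i=-int M..int M. g (x + of_int i) - g (of_int i)) has_real_derivative
     (\<Sum>i=-int M..int M. 1 / pi * (\<Sum>k=1..K. if x + of_int i \<in> {\<alpha> k..\<beta> k}
        then \<bar>deriv (\<lambda>y. arccos (r k (y + of_int i))) x\<bar> else 0) - 0)) (at x within A)"
    unfolding g_fun_def by (intro DERIV_sum DERIV_diff DERIV_cmult DERIV_const S)
  then show ?thesis
    by (simp add: f_fun_def[abs_def] f_deriv_def sum_distrib_left)
qed

end

theorem theorem1:
  fixes \<theta> :: real and m K M :: nat and P :: "int poly" and c \<alpha> \<beta> :: "nat \<Rightarrow> real"
  assumes "salem_number \<theta>" and "algebraic_degree (complex_of_real \<theta>) = 4"
    and "m > 0" and "degree P = m"
    and "critical_partition (Q_poly P) K c"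
    and "\<forall>k\<in>{1..K}. poly (Q_poly P) ` {c (k-1)..c k} = {\<alpha> k..\<beta> k} \<and> \<alpha> k < \<beta> k"
    and "real M \<ge> Max ((\<lambda>k. \<bar>\<alpha> k\<bar>) ` {1..K} \<union> (\<lambda>k. \<bar>\<beta> k\<bar>) ` {1..K})"
  shows "has_repartition_function (\<lambda>n. poly (map_poly of_int P) (\<theta> ^ n))
           (f_fun (Q_poly P) K c \<alpha> \<beta> M)
       \<and> (\<forall>x\<in>{0..1}.
            (\<forall>i\<in>{-int M..int M}. \<forall>k\<in>{1..K}. x + of_int i \<noteq> \<alpha> k \<and> x + of_int i \<noteq> \<beta> k) \<longrightarrow>
            (f_fun (Q_poly P) K c \<alpha> \<beta> M has_real_derivative f_deriv (Q_poly P) K c \<alpha> \<beta> M x)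
              (at x within {0..1}))"
proof -
  obtain \<phi> where trace: "\<And>n. \<theta> ^ n + inverse \<theta> ^ n + 2 * cos (real n * \<phi>) \<in> \<int>"
    and aperiodic: "\<And>j. j > 0 \<Longrightarrow> cis (real j * \<phi>) \<noteq> 1"
    using salem_degree_4_trace[OF assms(1,2)] by blast
  have angle: "equidistributed_angle \<phi>" using aperiodic by (simp add: equidistributed_angle_def)
  have "\<theta> > 1" using assms(1) by (simp add: salem_number_def)
  then interpret salem_sequence \<theta> \<phi> P K M c \<alpha> \<beta>
    using trace angle assms by (intro salem_sequence.intro) auto
  show ?thesis using repartition derivative by blast
qed

end
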